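(* Let $(\mathcal M,g)$ be a Riemannian manifold without boundary of class $C^2$ modelled over a Hilbert space $\mathcal H$, and let $\mathcal E\in C^{1,1}_{\mathrm{loc}}(\mathcal M)$ be real-valued. Suppose that $\mathcal E$ satisfies the Palais–Smale condition, and (e) there is $e\in\mathbb R$ such that $\mathcal E(x)\ge e$ for all $x\in\mathcal M$; (L** ) every Cauchy sequence $(x_k)$ in $\mathcal M$ with respect to the path metric such that $(\mathcal E(x_k))_k$ is bounded converges to some $x_\infty\in\mathcal M$. Then there exists a function $\phi:[0,\infty)\times\mathcal M\to\mathcal M$ such that $\phi(\cdot,x)\in C^1([0,\infty),\mathcal M)$ for every $x\in\mathcal M$ and $$\frac{d}{dt}\phi(t,x)=-\nabla\mathcal E(\phi(t,x))\quad\text{for all }t\in[0,\infty),\qquad\phi(0,x)=x.$$ The function $t\mapsto\mathcal E(\phi(t,x))$ is strictly decreasing on $[0,\infty)$ unless $x$ is $\mathcal E$-critical. For $x\in\mathcal M$ and $t\to\infty$ the solution $\phi(t,x)$ subconverges to a critical point of $\mathcal E$, which lies in the same connected component of $\mathcal M$ as the initial point $x$. In particular, in each connected component of $\mathcal M$ the energy $\mathcal E$ possesses at least one critical point.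
   Context: The Riemannian metric $g$ is given fibrewise by inner products $g_x$ on $T_x\mathcal M$ (a strong metric of class $C^1$: $\|\cdot\|_{g_x}=\sqrt{g_x(\cdot,\cdot)}$ is equivalent to the norm of the model space). The gradient is defined by $D\mathcal E_x(h)=g_x(\nabla\mathcal E(x),h)$ for $h\in T_x\mathcal M$; $\mathcal E\in C^{1,1}_{\mathrm{loc}}$ means $C^1$ with locally Lipschitz differential. A point $x$ is $\mathcal E$-critical if $D\mathcal E_x=0$. Path metric: for $x,y$ in the same connected component, $\mathrm{dist}_{\mathcal M}(x,y)=\inf_c\int_0^1\|\dot c(t)\|_{g_{c(t)}}\,dt$, the infimum over all $c\in C^1([0,1],\mathcal M)$ with $c(0)=x$, $c(1)=y$. Cauchy sequences in $\mathcal M$ are understood to lie, up to finitely many members, in one connected component. A Palais–Smale sequence for $\mathcal E$ is $(x_k)\subset\mathcal M$ with $\sup_k\mathcal E(x_k)<\infty$ and $\|D\mathcal E_{x_k}\|_{(T_{x_k}\mathcal M)^*}\to0$ (dual norm with respect to $\|\cdot\|_{g_{x_k}}$). The Palais–Smale condition: every Palais–Smale sequence has a subsequence converging in $\mathcal M$. "$\phi(t,x)$ subconverges to $y$ as $t\to\infty$" means $\phi(t_k,x)\to y$ for some sequence $t_k\to\infty$. *)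

theory Defs
  imports "HOL-Analysis.Analysis"
begin

section \<open>Differentiability classes on open subsets of normed spaces\<close>

definition C1_on :: "'a::real_normed_vector set \<Rightarrow> ('a \<Rightarrow> 'b::real_normed_vector) \<Rightarrow> bool" where
  "C1_on S f \<longleftrightarrow> (\<exists>f' :: 'a \<Rightarrow> 'a \<Rightarrow>\<^sub>L 'b.
     (\<forall>y\<in>S. (f has_derivative blinfun_apply (f' y)) (at y)) \<and> continuous_on S f')"

definition C2_on :: "'a::real_normed_vector set \<Rightarrow> ('a \<Rightarrow> 'b::real_normed_vector) \<Rightarrow> bool" where
  "C2_on S f \<longleftrightarrow> (\<exists>f' :: 'a \<Rightarrow> 'a \<Rightarrow>\<^sub>L 'b.
     (\<forall>y\<in>S. (f has_derivative blinfun_apply (f' y)) (at y)) \<and> C1_on S f')"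

text \<open>Continuity of the derivative need not be stated separately: it follows from the local Lipschitz condition.\<close>

definition C11_loc_on :: "'a::real_normed_vector set \<Rightarrow> ('a \<Rightarrow> 'b::real_normed_vector) \<Rightarrow> bool" where
  "C11_loc_on S f \<longleftrightarrow> (\<exists>f' :: 'a \<Rightarrow> 'a \<Rightarrow>\<^sub>L 'b.
     (\<forall>y\<in>S. (f has_derivative blinfun_apply (f' y)) (at y)) \<and>
     (\<forall>y\<in>S. \<exists>r>0. \<exists>L. L-lipschitz_on (ball y r \<inter> S) f'))"


section \<open>Manifolds modelled over a Hilbert space\<close>

text \<open>
  The manifold is the whole type \<open>'m\<close> with its Hausdorff topology.  A chart is a pair of its domain
  and a map into the model space; the values of the map outside the domain are irrelevant.
\<close>

type_synonym ('m, 'h) chart = "'m set \<times> ('m \<Rightarrow> 'h)"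

abbreviation cdom :: "('m, 'h) chart \<Rightarrow> 'm set" where "cdom c \<equiv> fst c"

abbreviation cmap :: "('m, 'h) chart \<Rightarrow> 'm \<Rightarrow> 'h" where "cmap c \<equiv> snd c"

definition cinv :: "('m, 'h) chart \<Rightarrow> 'h \<Rightarrow> 'm" where
  "cinv c = inv_into (cdom c) (cmap c)"

definition transition :: "('m, 'h) chart \<Rightarrow> ('m, 'h) chart \<Rightarrow> 'h \<Rightarrow> 'h" where
  "transition c d = cmap d \<circ> cinv c"

definition C2_atlas :: "('m::t2_space, 'h::{real_inner,complete_space}) chart set \<Rightarrow> bool" where
  "C2_atlas A \<longleftrightarrow>
     (\<Union>c\<in>A. cdom c) = UNIV \<and>
     (\<forall>c\<in>A. open (cdom c) \<and> open (cmap c ` cdom c) \<and>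
        homeomorphism (cdom c) (cmap c ` cdom c) (cmap c) (cinv c)) \<and>
     (\<forall>c\<in>A. \<forall>d\<in>A. C2_on (cmap c ` (cdom c \<inter> cdom d)) (transition c d))"

text \<open>
  A tangent vector at \<open>x\<close> is the family of its coordinates with respect to all charts around \<open>x\<close>,
  related to each other by the derivatives of the transition maps; the family is padded
  by \<open>0\<close> at all other arguments.  The linear structure is the pointwise one.
\<close>

type_synonym ('m, 'h) tangent = "('m, 'h) chart \<Rightarrow> 'h"

definition tangent_space ::
    "('m, 'h::real_normed_vector) chart set \<Rightarrow> 'm \<Rightarrow> ('m, 'h) tangent set" where
  "tangent_space A x = {v.
     (\<forall>c. \<not> (c \<in> A \<and> x \<in> cdom c) \<longrightarrow> v c = 0) \<and>
     (\<forall>c\<in>A. \<forall>d\<in>A. x \<in> cdom c \<and> x \<in> cdom d \<longrightarrow>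
        v d = frechet_derivative (transition c d) (at (cmap c x)) (v c))}"


section \<open>Riemannian metrics\<close>

definition inner_product_on :: "('i \<Rightarrow> 'h::real_vector) set \<Rightarrow> (('i \<Rightarrow> 'h) \<Rightarrow> ('i \<Rightarrow> 'h) \<Rightarrow> real) \<Rightarrow> bool" where
  "inner_product_on T B \<longleftrightarrow>
     (\<forall>u\<in>T. \<forall>v\<in>T. B u v = B v u) \<and>
     (\<forall>u\<in>T. \<forall>v\<in>T. \<forall>w\<in>T. B (\<lambda>i. u i + v i) w = B u w + B v w) \<and>
     (\<forall>r. \<forall>u\<in>T. \<forall>v\<in>T. B (\<lambda>i. r *\<^sub>R u i) v = r * B u v) \<and>
     (\<forall>v\<in>T. v \<noteq> (\<lambda>i. 0) \<longrightarrow> 0 < B v v)"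

type_synonym ('m, 'h) metric_tensor = "'m \<Rightarrow> ('m, 'h) tangent \<Rightarrow> ('m, 'h) tangent \<Rightarrow> real"

definition tnorm :: "('m, 'h) metric_tensor \<Rightarrow> 'm \<Rightarrow> ('m, 'h) tangent \<Rightarrow> real" where
  "tnorm g x v = sqrt (g x v v)"

definition strong_C1_metric ::
    "('m, 'h::{real_inner,complete_space}) chart set \<Rightarrow> ('m, 'h) metric_tensor \<Rightarrow> bool" where
  "strong_C1_metric A g \<longleftrightarrow>
     (\<forall>x. inner_product_on (tangent_space A x) (g x)) \<and>
     (\<forall>c\<in>A. \<forall>x\<in>cdom c. \<exists>a>0. \<exists>b>0. \<forall>v\<in>tangent_space A x.
        a * norm (v c) \<le> tnorm g x v \<and> tnorm g x v \<le> b * norm (v c)) \<and>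
     (\<forall>c\<in>A. \<exists>G :: 'h \<Rightarrow> 'h \<Rightarrow>\<^sub>L 'h \<Rightarrow>\<^sub>L real. C1_on (cmap c ` cdom c) G \<and>
        (\<forall>x\<in>cdom c. \<forall>v\<in>tangent_space A x. \<forall>w\<in>tangent_space A x.
           g x v w = blinfun_apply (blinfun_apply (G (cmap c x)) (v c)) (w c)))"

definition riemannian_manifold ::
    "('m::t2_space, 'h::{real_inner,complete_space}) chart set \<Rightarrow> ('m, 'h) metric_tensor \<Rightarrow> bool" where
  "riemannian_manifold A g \<longleftrightarrow> C2_atlas A \<and> strong_C1_metric A g"


section \<open>Curves and the path metric\<close>

text \<open>
  Derivatives of curves are taken within the parameter interval \<open>I\<close>, hence are one-sided at
  endpoints belonging to \<open>I\<close>.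
\<close>

definition velocity ::
    "('m, 'h::real_normed_vector) chart set \<Rightarrow> real set \<Rightarrow> (real \<Rightarrow> 'm) \<Rightarrow> real \<Rightarrow> ('m, 'h) tangent" where
  "velocity A I \<gamma> t = (\<lambda>c. if c \<in> A \<and> \<gamma> t \<in> cdom c
     then vector_derivative (cmap c \<circ> \<gamma>) (at t within I) else 0)"

definition C1_curve ::
    "('m::topological_space, 'h::real_normed_vector) chart set \<Rightarrow> real set \<Rightarrow> (real \<Rightarrow> 'm) \<Rightarrow> bool" where
  "C1_curve A I \<gamma> \<longleftrightarrow> continuous_on I \<gamma> \<and>
     (\<forall>c\<in>A. (\<forall>t\<in>{t\<in>I. \<gamma> t \<in> cdom c}. (cmap c \<circ> \<gamma>) differentiable (at t within I)) \<and>
        continuous_on {t\<in>I. \<gamma> t \<in> cdom c} (\<lambda>t. vector_derivative (cmap c \<circ> \<gamma>) (at t within I)))"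

definition curve_length ::
    "('m, 'h::real_normed_vector) chart set \<Rightarrow> ('m, 'h) metric_tensor \<Rightarrow> (real \<Rightarrow> 'm) \<Rightarrow> real" where
  "curve_length A g \<gamma> = integral {0..1} (\<lambda>t. tnorm g (\<gamma> t) (velocity A {0..1} \<gamma> t))"

text \<open>Only meaningful for points in the same connected component.\<close>

definition path_dist ::
    "('m::topological_space, 'h::real_normed_vector) chart set \<Rightarrow> ('m, 'h) metric_tensor \<Rightarrow> 'm \<Rightarrow> 'm \<Rightarrow> real" where
  "path_dist A g x y =
     Inf {curve_length A g \<gamma> | \<gamma>. C1_curve A {0..1} \<gamma> \<and> \<gamma> 0 = x \<and> \<gamma> 1 = y}"

definition path_Cauchy ::
    "('m::topological_space, 'h::real_normed_vector) chart set \<Rightarrow> ('m, 'h) metric_tensor \<Rightarrow> (nat \<Rightarrow> 'm) \<Rightarrow> bool" where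
  "path_Cauchy A g X \<longleftrightarrow>
     (\<exists>N. \<forall>m\<ge>N. \<forall>n\<ge>N. connected_component UNIV (X m) (X n)) \<and>
     (\<forall>\<epsilon>>0. \<exists>N. \<forall>m\<ge>N. \<forall>n\<ge>N. path_dist A g (X m) (X n) < \<epsilon>)"


section \<open>Energies, gradients and the Palais--Smale condition\<close>

definition C11_loc_energy :: "('m, 'h::real_normed_vector) chart set \<Rightarrow> ('m \<Rightarrow> real) \<Rightarrow> bool" where
  "C11_loc_energy A E \<longleftrightarrow> (\<forall>c\<in>A. C11_loc_on (cmap c ` cdom c) (E \<circ> cinv c))"

text \<open>
  The differential is computed in an arbitrarily selected chart around \<open>x\<close>; for a \<open>C\<^sup>1\<close> energy the
  value on tangent vectors does not depend on that choice.
\<close>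

definition differential ::
    "('m, 'h::real_normed_vector) chart set \<Rightarrow> ('m \<Rightarrow> real) \<Rightarrow> 'm \<Rightarrow> ('m, 'h) tangent \<Rightarrow> real" where
  "differential A E x h =
     (let c = (SOME c. c \<in> A \<and> x \<in> cdom c)
      in frechet_derivative (E \<circ> cinv c) (at (cmap c x)) (h c))"

definition gradient ::
    "('m, 'h::real_normed_vector) chart set \<Rightarrow> ('m, 'h) metric_tensor \<Rightarrow> ('m \<Rightarrow> real) \<Rightarrow> 'm \<Rightarrow> ('m, 'h) tangent" where
  "gradient A g E x = (THE v. v \<in> tangent_space A x \<and>
     (\<forall>h\<in>tangent_space A x. differential A E x h = g x v h))"

definition critical_point ::
    "('m, 'h::real_normed_vector) chart set \<Rightarrow> ('m \<Rightarrow> real) \<Rightarrow> 'm \<Rightarrow> bool" where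
  "critical_point A E x \<longleftrightarrow> (\<forall>h\<in>tangent_space A x. differential A E x h = 0)"

definition differential_norm ::
    "('m, 'h::real_normed_vector) chart set \<Rightarrow> ('m, 'h) metric_tensor \<Rightarrow> ('m \<Rightarrow> real) \<Rightarrow> 'm \<Rightarrow> real" where
  "differential_norm A g E x =
     (SUP h\<in>{h \<in> tangent_space A x. tnorm g x h \<le> 1}. \<bar>differential A E x h\<bar>)"

definition palais_smale_seq ::
    "('m, 'h::real_normed_vector) chart set \<Rightarrow> ('m, 'h) metric_tensor \<Rightarrow> ('m \<Rightarrow> real) \<Rightarrow> (nat \<Rightarrow> 'm) \<Rightarrow> bool" where
  "palais_smale_seq A g E X \<longleftrightarrow>
     bdd_above (range (\<lambda>k. E (X k))) \<and> (\<lambda>k. differential_norm A g E (X k)) \<longlonglongrightarrow> 0"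

definition palais_smale ::
    "('m::topological_space, 'h::real_normed_vector) chart set \<Rightarrow> ('m, 'h) metric_tensor \<Rightarrow> ('m \<Rightarrow> real) \<Rightarrow> bool" where
  "palais_smale A g E \<longleftrightarrow> (\<forall>X. palais_smale_seq A g E X \<longrightarrow>
     (\<exists>r :: nat \<Rightarrow> nat. \<exists>y. strict_mono r \<and> (X \<circ> r) \<longlonglongrightarrow> y))"

end

theory Submission
  imports Defs
begin

text \<open>
  The curve \<open>t \<mapsto> \<phi>(t, x)\<close> is the integral curve of \<open>- \<nabla>E\<close> starting at \<open>x\<close>.  In a chart the gradient
  solves the equation \<open>G(y) F(y) = DE(y)\<close>, whose left-hand side is coercive.  The Lax--Milgram theorem
  (\<open>lax_milgram_symmetric\<close>) gives the solution, and coercivity, the \<open>C\<^sup>1\<close> dependence of \<open>G\<close> and the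
  Lipschitz continuity of \<open>DE\<close> make \<open>F\<close> locally Lipschitz (\<open>coercive_solution_locally_lipschitz\<close>).
  Hence integral curves exist locally (\<open>picard_lindelof_hilbert\<close>) and are unique
  (\<open>descent_curve_unique\<close>).

  An integral curve cannot break down in finite time.  Along it,
  \<open>d/dt E(\<gamma> t) = - \<parallel>\<nabla>E(\<gamma> t)\<parallel>\<^sup>2\<close>, so by \<open>\<parallel>\<nabla>E\<parallel> \<le> (1 + \<parallel>\<nabla>E\<parallel>\<^sup>2) / 2\<close> its length between the times \<open>s\<close> and
  \<open>t\<close> is at most half the increment of the increasing function \<open>t - E(\<gamma> t)\<close>
  (\<open>path_dist_descent_curve_le\<close>).  On a bounded time interval this function is bounded, because \<open>E\<close> is
  bounded below.  The points on the curve at times tending to \<open>T\<close> therefore form a Cauchy sequence with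
  bounded energy, the curve has a limit at \<open>T\<close> (\<open>descent_curve_finite_time_limit\<close>), and it can be
  restarted there.  So the set of reachable times has no finite supremum (\<open>descent_curve_exists\<close>).

  A critical point is a constant integral curve, so by uniqueness no other integral curve meets it in
  finite time; this makes the decrease of the energy strict.  Finally, the energy converges along the
  curve, so its decrease over \<open>[k, k + 1]\<close> tends to \<open>0\<close>; by the mean value theorem this decrease
  equals \<open>\<parallel>\<nabla>E\<parallel>\<^sup>2\<close> at some intermediate time.  These times give a Palais--Smale sequence, and a limit of
  a subsequence is a critical point in the closure of the curve (\<open>descent_curve_subconverges\<close>).
\<close>

section \<open>The Lax--Milgram theorem and ordinary differential equations in Hilbert spaces\<close>

text \<open>
  The solution is the minimizer of the quadratic functional \<open>J v = B v v - 2 f v\<close>.  By the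
  parallelogram identity and coercivity, minimizing sequences are Cauchy, so the minimum is attained;
  there the directional derivatives \<open>2 (B v h - f h)\<close> of \<open>J\<close> vanish.
\<close>

lemma lax_milgram_symmetric:
  fixes B :: "'h::{real_inner,complete_space} \<Rightarrow>\<^sub>L 'h \<Rightarrow>\<^sub>L real" and f :: "'h \<Rightarrow>\<^sub>L real"
  assumes sym: "\<And>u v. B u v = B v u" and "0 < \<kappa>" and coercive: "\<And>v. \<kappa> * (norm v)\<^sup>2 \<le> B v v"
  shows "\<exists>v. \<forall>h. B v h = f h"
proof -
  define J where "J v = B v v - 2 * f v" for v
  have lower: "- ((norm f)\<^sup>2 / \<kappa>) \<le> J v" for v
  proof -
    have "f v \<le> norm f * norm v"
      using norm_blinfun[of f v] by simp
    moreover have "0 \<le> \<kappa> * (norm v)\<^sup>2 - 2 * norm f * norm v + (norm f)\<^sup>2 / \<kappa>"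
    proof -
      have "\<kappa> * (norm v)\<^sup>2 - 2 * norm f * norm v + (norm f)\<^sup>2 / \<kappa> = (\<kappa> * norm v - norm f)\<^sup>2 / \<kappa>"
        using \<open>0 < \<kappa>\<close> by (simp add: power2_eq_square field_simps)
      then show ?thesis
        using \<open>0 < \<kappa>\<close> by simp
    qed
    ultimately show ?thesis
      using coercive[of v] unfolding J_def by linarith
  qed
  define m where "m = (INF v. J v)"
  have bdd: "bdd_below (range J)"
    using lower by (rule bdd_belowI2)
  have m: "m \<le> J v" for v
    unfolding m_def using bdd by (rule cINF_lower) simp
  have near: "\<exists>v. J v < m + inverse (Suc n)" for n
  proof -
    have "(INF v. J v) < m + inverse (Suc n)"
      unfolding m_def by simp
    then show ?thesis
      using cINF_less_iff[of UNIV J, OF _ bdd] by simp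
  qed
  then obtain X where X: "\<And>n. J (X n) < m + inverse (Suc n)"
    by metis
  have parallelogram: "\<kappa> / 2 * (norm (u - v))\<^sup>2 \<le> J u + J v - 2 * m" for u v
  proof -
    have "J u + J v = 2 * J ((1/2) *\<^sub>R (u + v)) + 1/2 * B (u - v) (u - v)"
      unfolding J_def
      by (simp add: blinfun.bilinear_simps sym[of v u] field_simps)
    then show ?thesis
      using coercive[of "u - v"] m[of "(1/2) *\<^sub>R (u + v)"] by linarith
  qed
  have "Cauchy X"
  proof (rule CauchyI)
    fix e :: real
    assume "0 < e"
    then have "0 < \<kappa> * e\<^sup>2 / 4"
      using \<open>0 < \<kappa>\<close> by simp
    then obtain N where N: "inverse (real (Suc N)) < \<kappa> * e\<^sup>2 / 4"
      using reals_Archimedean by blast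
    have "norm (X i - X j) < e" if "N \<le> i" "N \<le> j" for i j
    proof -
      have "inverse (real (Suc i)) \<le> inverse (real (Suc N))" "inverse (real (Suc j)) \<le> inverse (real (Suc N))"
        using that by (simp_all add: field_simps)
      then have "\<kappa> / 2 * (norm (X i - X j))\<^sup>2 < 2 * (\<kappa> * e\<^sup>2 / 4)"
        using parallelogram[of "X i" "X j"] X[of i] X[of j] N by linarith
      then have "\<kappa> / 2 * (norm (X i - X j))\<^sup>2 < \<kappa> / 2 * e\<^sup>2"
        by simp
      then have "(norm (X i - X j))\<^sup>2 < e\<^sup>2"
        using \<open>0 < \<kappa>\<close> by simp
      then show ?thesis
        using \<open>0 < e\<close> by (simp add: power2_less_imp_less)
    qed
    then show "\<exists>M. \<forall>i\<ge>M. \<forall>j\<ge>M. norm (X i - X j) < e"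
      by blast
  qed
  then obtain v where v: "X \<longlonglongrightarrow> v"
    using Cauchy_convergent_iff convergent_def by blast
  have "(\<lambda>n. J (X n)) \<longlonglongrightarrow> J v"
    unfolding J_def by (intro tendsto_intros v)
  moreover have "(\<lambda>n. J (X n)) \<longlonglongrightarrow> m"
  proof (rule tendsto_sandwich[OF _ _ tendsto_const])
    have "(\<lambda>n. m + inverse (real (Suc n))) \<longlonglongrightarrow> m + 0"
      by (intro tendsto_intros LIMSEQ_inverse_real_of_nat)
    then show "(\<lambda>n. m + inverse (real (Suc n))) \<longlonglongrightarrow> m"
      by simp
  qed (use X m in \<open>auto intro!: always_eventually less_imp_le simp del: of_nat_Suc\<close>)
  ultimately have min: "J v = m"
    using LIMSEQ_unique by blast
  have "B v h = f h" for h
  proof (rule ccontr)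
    define q where "q = B v h - f h"
    assume "B v h \<noteq> f h"
    then have "h \<noteq> 0" and q: "q \<noteq> 0"
      unfolding q_def by (auto simp: blinfun.bilinear_simps)
    then have "0 < B h h"
      using coercive[of h] \<open>0 < \<kappa>\<close> by (smt (verit) zero_less_mult_iff zero_less_norm_iff zero_less_power)
    \<comment> \<open>The step \<open>q / B h h\<close> minimizes \<open>J\<close> on the line through \<open>v\<close> in direction \<open>h\<close>.\<close>
    have "J (v - (q / B h h) *\<^sub>R h) = J v - q\<^sup>2 / B h h"
      unfolding J_def q_def using \<open>0 < B h h\<close>
      by (simp add: blinfun.bilinear_simps sym[of h v] field_simps power2_eq_square)
    moreover have "0 < q\<^sup>2 / B h h"
      using \<open>0 < B h h\<close> q by simp
    ultimately show False
      using m[of "v - (q / B h h) *\<^sub>R h"] min by simp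
  qed
  then show ?thesis
    by blast
qed

lemma riesz_representation:
  fixes f :: "'h::{real_inner,complete_space} \<Rightarrow>\<^sub>L real"
  shows "\<exists>v. f = blinfun_inner_right v"
proof -
  define B :: "'h \<Rightarrow>\<^sub>L 'h \<Rightarrow>\<^sub>L real" where "B = Blinfun blinfun_inner_right"
  have B: "B u v = u \<bullet> v" for u v
  proof -
    have "bounded_linear (blinfun_inner_right :: 'h \<Rightarrow> _)"
      by (rule bounded_linear_blinfun_inner_right)
    then show ?thesis
      unfolding B_def by (simp add: bounded_linear_Blinfun_apply blinfun_inner_right.rep_eq)
  qed
  have "\<exists>v. \<forall>h. B v h = f h"
    by (rule lax_milgram_symmetric[of B 1]) (auto simp: B inner_commute power2_norm_eq_inner)
  then obtain v where "\<And>h. v \<bullet> h = f h"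
    by (auto simp: B)
  then have "f = blinfun_inner_right v"
    by (intro blinfun_eqI) simp
  then show ?thesis
    by blast
qed

text \<open>
  On an interval so short that \<open>\<delta> M \<le> r\<close>, where \<open>M\<close> bounds \<open>F\<close>, the integral operator
  \<open>w \<mapsto> x0 + \<integral> F(w s) ds\<close> preserves the curves in the ball, and for \<open>L \<delta> \<le> 1/2\<close> it is a contraction of
  them.  Its fixed point is the solution.
\<close>

lemma picard_lindelof_banach:
  fixes F :: "'a::banach \<Rightarrow> 'a"
  assumes "0 < r" and lip: "L-lipschitz_on (cball x0 r) F"
  shows "\<exists>\<delta>>0. \<exists>z. z 0 = x0 \<and> (\<forall>t\<in>{0..\<delta>}. z t \<in> cball x0 r \<and>
           (z has_vector_derivative F (z t)) (at t within {0..\<delta>}))"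
proof -
  have "0 \<le> L" and lipD: "\<And>u v. u \<in> cball x0 r \<Longrightarrow> v \<in> cball x0 r \<Longrightarrow> norm (F u - F v) \<le> L * norm (u - v)"
    using lip unfolding lipschitz_on_def dist_norm by auto
  have contF: "continuous_on (cball x0 r) F"
    using lip by (rule lipschitz_on_continuous_on)
  define M where "M = norm (F x0) + L * r"
  have "0 \<le> M"
    unfolding M_def using \<open>0 \<le> L\<close> \<open>0 < r\<close> by simp
  have M: "norm (F u) \<le> M" if "u \<in> cball x0 r" for u
  proof -
    have "norm (F u - F x0) \<le> L * norm (u - x0)"
      using that \<open>0 < r\<close> by (intro lipD) auto
    also have "\<dots> \<le> L * r"
      using that \<open>0 \<le> L\<close> by (intro mult_left_mono) (auto simp: dist_norm norm_minus_commute)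
    finally show ?thesis
      unfolding M_def using norm_triangle_ineq2[of "F u" "F x0"] by linarith
  qed
  define \<delta> where "\<delta> = min (r / (M + 1)) (1 / (2 * L + 1))"
  have "0 < \<delta>" "\<delta> * M \<le> r" "L * \<delta> \<le> 1/2"
  proof -
    show "0 < \<delta>"
      unfolding \<delta>_def using \<open>0 < r\<close> \<open>0 \<le> M\<close> \<open>0 \<le> L\<close> by simp
    have "\<delta> * M \<le> r / (M + 1) * M"
      unfolding \<delta>_def using \<open>0 \<le> M\<close> by (intro mult_right_mono) auto
    also have "\<dots> \<le> r"
      using \<open>0 < r\<close> \<open>0 \<le> M\<close> by (simp add: field_simps)
    finally show "\<delta> * M \<le> r" .
    have "L * \<delta> \<le> L * (1 / (2 * L + 1))"
      unfolding \<delta>_def using \<open>0 \<le> L\<close> by (intro mult_left_mono) auto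
    also have "\<dots> \<le> 1/2"
      using \<open>0 \<le> L\<close> by (simp add: field_simps)
    finally show "L * \<delta> \<le> 1/2" .
  qed
  \<comment> \<open>Curves are bounded continuous functions on the whole line; clipping the time makes them constant outside \<open>[0, \<delta>]\<close>.\<close>
  define clip where "clip t = max 0 (min t \<delta>)" for t
  have clip: "clip t \<in> {0..\<delta>}" and clip_id: "t \<in> {0..\<delta>} \<Longrightarrow> clip t = t" for t
    unfolding clip_def using \<open>0 < \<delta>\<close> by auto
  define S where "S = PiC UNIV (\<lambda>_::real. cball x0 r)"
  have S: "apply_bcontfun w t \<in> cball x0 r" if "w \<in> S" for w t
    using that unfolding S_def mem_PiC_iff by blast
  define V where "V w t = integral {0..t} (\<lambda>s. F (apply_bcontfun w s))" for w :: "real \<Rightarrow>\<^sub>C 'a" and t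
  have cont: "continuous_on T (\<lambda>s. F (apply_bcontfun w s))" if "w \<in> S" for w T
    using continuous_on_compose2[OF contF continuous_on_apply_bcontfun] S[OF that] by blast
  have int: "(\<lambda>s. F (apply_bcontfun w s)) integrable_on {0..t}" if "w \<in> S" for w t
    using cont[OF that] by (rule integrable_continuous_real)
  define P where "P w = Bcontfun (\<lambda>t. x0 + V w (clip t))" for w
  have P: "apply_bcontfun (P w) t = x0 + V w (clip t)"
    and P_ball: "x0 + V w (clip t) \<in> cball x0 r" if "w \<in> S" for w t
  proof -
    show ball: "x0 + V w (clip t) \<in> cball x0 r" for t
    proof -
      have "norm (V w (clip t)) \<le> M * (clip t - 0)"
        unfolding V_def using clip[of t] that
        by (intro integral_bound cont M S) auto
      also have "\<dots> \<le> \<delta> * M"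
        using clip[of t] \<open>0 \<le> M\<close> by (simp add: mult.commute mult_left_mono)
      finally show ?thesis
        using \<open>\<delta> * M \<le> r\<close> by (simp add: dist_norm)
    qed
    have "continuous_on {0..\<delta>} (V w)"
      unfolding V_def using int[OF that] by (rule indefinite_integral_continuous_1)
    moreover have "continuous_on UNIV clip"
      unfolding clip_def by (intro continuous_intros)
    ultimately have "continuous_on UNIV (\<lambda>t. V w (clip t))"
      using clip by (intro continuous_on_compose2[of "{0..\<delta>}" "V w" UNIV clip]) auto
    then have "continuous_on UNIV (\<lambda>t. x0 + V w (clip t))"
      by (intro continuous_intros)
    moreover have "bounded (range (\<lambda>t. x0 + V w (clip t)))"
      using ball by (intro bounded_subset[OF bounded_cball, of _ x0 r]) blast
    ultimately have "(\<lambda>t. x0 + V w (clip t)) \<in> bcontfun"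
      unfolding bcontfun_def by blast
    then show "apply_bcontfun (P w) t = x0 + V w (clip t)"
      unfolding P_def by (simp add: Bcontfun_inverse)
  qed
  have "\<exists>!w\<in>S. P w = w"
  proof (rule Banach_fix)
    show "complete S"
      unfolding S_def by (intro closed_PiC[THEN complete_eq_closed[THEN iffD2]]) auto
    have "const_bcontfun x0 \<in> S"
      unfolding S_def mem_PiC_iff using \<open>0 < r\<close> by simp
    then show "S \<noteq> {}"
      by blast
    show "0 \<le> (1/2::real)" "(1/2::real) < 1"
      by simp_all
    show "P ` S \<subseteq> S"
    proof
      fix v
      assume "v \<in> P ` S"
      then obtain w where w: "w \<in> S" "v = P w"
        by blast
      then have "apply_bcontfun v t \<in> cball x0 r" for t
        using P[OF w(1), of t] P_ball[OF w(1), of t] by simp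
      then show "v \<in> S"
        unfolding S_def mem_PiC_iff by blast
    qed
    show "dist (P v) (P w) \<le> 1/2 * dist v w" if v: "v \<in> S" and w: "w \<in> S" for v w
    proof (rule dist_bound)
      fix t
      have "dist (apply_bcontfun (P v) t) (apply_bcontfun (P w) t)
          = norm (integral {0..clip t} (\<lambda>s. F (apply_bcontfun v s) - F (apply_bcontfun w s)))"
        unfolding P[OF v] P[OF w] V_def dist_norm
        by (simp add: integral_diff int v w)
      also have "\<dots> \<le> (L * dist v w) * (clip t - 0)"
      proof (rule integral_bound)
        show "continuous_on {0..clip t} (\<lambda>s. F (apply_bcontfun v s) - F (apply_bcontfun w s))"
          by (intro continuous_intros cont v w)
        show "norm (F (apply_bcontfun v s) - F (apply_bcontfun w s)) \<le> L * dist v w" for s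
          using lipD[OF S[OF v] S[OF w], of s s] dist_bounded[of v s w] \<open>0 \<le> L\<close>
          by (smt (verit) dist_norm mult_left_mono)
      qed (use clip[of t] in simp)
      also have "\<dots> \<le> (L * dist v w) * \<delta>"
        using clip[of t] \<open>0 \<le> L\<close> by (intro mult_left_mono) auto
      also have "\<dots> \<le> 1/2 * dist v w"
        using mult_right_mono[OF \<open>L * \<delta> \<le> 1/2\<close>, of "dist v w"] by (simp add: mult_ac)
      finally show "dist (apply_bcontfun (P v) t) (apply_bcontfun (P w) t) \<le> 1/2 * dist v w" .
    qed
  qed
  then obtain w where w: "w \<in> S" "P w = w"
    by blast
  define z where "z = apply_bcontfun w"
  have z: "z t = x0 + V w t" if "t \<in> {0..\<delta>}" for t
    using P[OF w(1), of t] clip_id[OF that] w(2) unfolding z_def by simp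
  have "z 0 = x0"
    using z[of 0] \<open>0 < \<delta>\<close> by (simp add: V_def)
  moreover have "(z has_vector_derivative F (z t)) (at t within {0..\<delta>})" if "t \<in> {0..\<delta>}" for t
  proof -
    have "(V w has_vector_derivative F (z t)) (at t within {0..\<delta>})"
      unfolding V_def z_def using cont[OF w(1)] that by (rule integral_has_vector_derivative)
    then have "((\<lambda>t. x0 + V w t) has_vector_derivative F (z t)) (at t within {0..\<delta>})"
      using has_vector_derivative_add[OF has_vector_derivative_const] by fastforce
    from has_vector_derivative_transform[OF that _ this] show ?thesis
      by (simp add: z)
  qed
  ultimately show ?thesis
    using \<open>0 < \<delta>\<close> S[OF w(1)] unfolding z_def by blast
qed

text \<open>
  A type of sort \<open>{real_inner, complete_space}\<close> is not of class \<open>banach\<close>, on which the theory of the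
  integral rests, but its dual space is.  By the Riesz theorem the two are isometric, so the differential
  equation can be solved in the dual space and the solution carried back.
\<close>

lemma picard_lindelof_hilbert:
  fixes F :: "'h::{real_inner,complete_space} \<Rightarrow> 'h"
  assumes "0 < r" and lip: "L-lipschitz_on (cball x0 r) F"
  shows "\<exists>\<delta>>0. \<exists>z. z 0 = x0 \<and> (\<forall>t\<in>{0..\<delta>}. z t \<in> cball x0 r \<and>
           (z has_vector_derivative F (z t)) (at t within {0..\<delta>}))"
proof -
  define R :: "'h \<Rightarrow> 'h \<Rightarrow>\<^sub>L real" where "R = blinfun_inner_right"
  define Q where "Q = inv R"
  have R: "bounded_linear R"
    unfolding R_def by (rule bounded_linear_blinfun_inner_right)
  interpret R: bounded_linear R
    by (rule R)
  have norm_R: "norm (R v) = norm v" for v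
  proof (rule antisym)
    show "norm (R v) \<le> norm v"
      unfolding R_def by (rule norm_blinfun_bound) (auto simp: Cauchy_Schwarz_ineq2)
    have "norm v * norm v = R v v"
      unfolding R_def by (simp add: dot_square_norm power2_eq_square)
    also have "\<dots> \<le> norm (R v) * norm v"
      using norm_blinfun[of "R v" v] by simp
    finally show "norm v \<le> norm (R v)"
      by (cases "v = 0") auto
  qed
  have inj: "inj R"
  proof (rule injI)
    fix u v
    assume "R u = R v"
    then show "u = v"
      using norm_R[of "u - v"] by (simp add: R.diff)
  qed
  have RQ: "R (Q f) = f" for f
    unfolding Q_def R_def using riesz_representation by (metis surjI surj_f_inv_f surj_def)
  have QR: "Q (R v) = v" for v
    unfolding Q_def using inj by simp
  have Q: "bounded_linear Q"
  proof (rule bounded_linear_intro)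
    show "Q (f + g) = Q f + Q g" for f g
      using inj by (metis QR R.add RQ)
    show "Q (a *\<^sub>R f) = a *\<^sub>R Q f" for a f
      by (metis QR R.scaleR RQ)
    show "norm (Q f) \<le> norm f * 1" for f
      using norm_R[of "Q f"] by (simp add: RQ)
  qed
  have dist_Q: "dist (Q f) (Q g) = dist f g" for f g
    using norm_R[of "Q f - Q g"] by (simp add: R.diff RQ dist_norm)
  have "L-lipschitz_on (cball (R x0) r) (\<lambda>f. R (F (Q f)))"
  proof (rule lipschitz_onI)
    show "0 \<le> L"
      using lip by (rule lipschitz_on_nonneg)
    fix f g
    assume "f \<in> cball (R x0) r" "g \<in> cball (R x0) r"
    then have "Q f \<in> cball x0 r" "Q g \<in> cball x0 r"
      using dist_Q[of "R x0"] by (auto simp: QR)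
    then have "dist (F (Q f)) (F (Q g)) \<le> L * dist (Q f) (Q g)"
      using lip by (rule lipschitz_onD[rotated 1])
    then show "dist (R (F (Q f))) (R (F (Q g))) \<le> L * dist f g"
      using dist_Q[of "R (F (Q f))" "R (F (Q g))"] by (simp add: QR dist_Q)
  qed
  then obtain \<delta> w where "0 < \<delta>" and w: "w 0 = R x0"
      "\<And>t. t \<in> {0..\<delta>} \<Longrightarrow> w t \<in> cball (R x0) r"
      "\<And>t. t \<in> {0..\<delta>} \<Longrightarrow> (w has_vector_derivative R (F (Q (w t)))) (at t within {0..\<delta>})"
    using picard_lindelof_banach[OF \<open>0 < r\<close>] by metis
  have "((\<lambda>t. Q (w t)) has_vector_derivative F (Q (w t))) (at t within {0..\<delta>})" if "t \<in> {0..\<delta>}" for t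
    using bounded_linear.has_vector_derivative[OF Q w(3)[OF that]] by (simp add: QR)
  moreover have "Q (w t) \<in> cball x0 r" if "t \<in> {0..\<delta>}" for t
    using w(2)[OF that] dist_Q[of "R x0" "w t"] by (simp add: QR)
  ultimately show ?thesis
    using \<open>0 < \<delta>\<close> w(1) QR by (intro exI[of _ \<delta>] conjI exI[of _ "\<lambda>t. Q (w t)"]) auto
qed

lemma at_within_interval_interior:
  fixes a b s :: real
  assumes "{a..b} \<subseteq> I" "a < s" "s < b"
  shows "at s within I = at s"
  using assms by (intro at_within_interior interior_maximal[THEN subsetD, of "{a<..<b}"]) auto

lemma unit_interval_limit_point: "s \<in> {0..1::real} \<Longrightarrow> at s within {0..1} \<noteq> bot"
  by (simp add: trivial_limit_within islimpt_Icc)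

text \<open>
  A continuous curve whose derivative extends continuously to the right endpoint is differentiable there.
  The mean value inequality is applied to \<open>z x - x V(b)\<close>, whose derivative is small near \<open>b\<close>.
\<close>

lemma has_vector_derivative_at_right_endpoint:
  fixes z :: "real \<Rightarrow> 'h::real_inner"
  assumes "a < b" and z: "continuous_on {a..b} z" and V: "continuous_on {a..b} V"
    and deriv: "\<And>s. a < s \<Longrightarrow> s < b \<Longrightarrow> (z has_vector_derivative V s) (at s)"
  shows "(z has_vector_derivative V b) (at b within {a..b})"
  unfolding has_vector_derivative_def has_derivative_within_alt
proof (intro conjI allI impI)
  show "bounded_linear (\<lambda>s. s *\<^sub>R V b)"
    by (rule bounded_linear_scaleR_left)
  fix e :: real
  assume "0 < e"
  then obtain d where "0 < d" and d: "\<And>s. s \<in> {a..b} \<Longrightarrow> dist s b < d \<Longrightarrow> dist (V s) (V b) < e"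
    using V \<open>a < b\<close> unfolding continuous_on_iff by (metis atLeastAtMost_iff less_imp_le order_refl)
  have "norm (z s - z b - (s - b) *\<^sub>R V b) \<le> e * norm (s - b)" if s: "s \<in> {a..b}" "norm (s - b) < d" for s
  proof (cases "s = b")
    case False
    then have "s < b"
      using s by simp
    have "\<exists>x\<in>{s<..<b}. norm ((z b - b *\<^sub>R V b) - (z s - s *\<^sub>R V b)) \<le> norm ((b - s) *\<^sub>R V x - (b - s) *\<^sub>R V b)"
    proof (rule mvt_general[OF \<open>s < b\<close>])
      show "continuous_on {s..b} (\<lambda>x. z x - x *\<^sub>R V b)"
        using s by (intro continuous_intros continuous_on_subset[OF z]) auto
      fix x
      assume "s < x" "x < b"
      then have "(z has_derivative (\<lambda>h. h *\<^sub>R V x)) (at x)"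
        using deriv s unfolding has_vector_derivative_def by simp
      then show "((\<lambda>x. z x - x *\<^sub>R V b) has_derivative (\<lambda>h. h *\<^sub>R V x - h *\<^sub>R V b)) (at x)"
        by (intro derivative_intros)
    qed
    then obtain x where x: "s < x" "x < b"
        "norm ((z b - b *\<^sub>R V b) - (z s - s *\<^sub>R V b)) \<le> norm ((b - s) *\<^sub>R V x - (b - s) *\<^sub>R V b)"
      by auto
    have "norm (z s - z b - (s - b) *\<^sub>R V b) = norm ((z b - b *\<^sub>R V b) - (z s - s *\<^sub>R V b))"
      by (subst norm_minus_commute) (simp add: algebra_simps)
    also have "\<dots> \<le> norm ((b - s) *\<^sub>R (V x - V b))"
      using x(3) by (simp add: scaleR_diff_right)
    also have "\<dots> \<le> (b - s) * e"
      using d[of x] x s \<open>s < b\<close> by (simp add: dist_norm)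
    finally show ?thesis
      using \<open>s < b\<close> by (simp add: mult.commute)
  qed simp
  then show "\<exists>d>0. \<forall>s\<in>{a..b}. norm (s - b) < d \<longrightarrow> norm (z s - z b - (s - b) *\<^sub>R V b) \<le> e * norm (s - b)"
    using \<open>0 < d\<close> by blast
qed

text \<open>
  The uniqueness half of the Gronwall argument: \<open>\<parallel>w\<parallel>\<^sup>2 exp(-2 L s)\<close> is decreasing and
  \<open>\<parallel>w\<parallel>\<^sup>2 exp(2 L s)\<close> is increasing.
\<close>

lemma linear_growth_zero_iff:
  fixes w :: "real \<Rightarrow> 'h::real_inner"
  assumes "a \<le> b" and w: "continuous_on {a..b} w"
    and deriv: "\<And>s. a < s \<Longrightarrow> s < b \<Longrightarrow> (w has_vector_derivative w' s) (at s)"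
    and bound: "\<And>s. a < s \<Longrightarrow> s < b \<Longrightarrow> norm (w' s) \<le> L * norm (w s)"
  shows "w a = 0 \<longleftrightarrow> w b = 0"
proof (cases "a = b")
  case False
  then have "a < b"
    using \<open>a \<le> b\<close> by simp
  define u where "u K s = (w s \<bullet> w s) * exp (K * s)" for K s :: real
  have cont: "continuous_on {a..b} (u K)" for K
    unfolding u_def by (intro continuous_intros w)
  have du: "(u K has_real_derivative (2 * (w s \<bullet> w' s) + K * (w s \<bullet> w s)) * exp (K * s)) (at s)"
    if "a < s" "s < b" for K s
  proof -
    have "(w has_derivative (\<lambda>h. h *\<^sub>R w' s)) (at s)"
      using deriv[OF that] unfolding has_vector_derivative_def .
    from has_derivative_inner[OF this this]
    have "((\<lambda>s. w s \<bullet> w s) has_real_derivative 2 * (w s \<bullet> w' s)) (at s)"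
      unfolding has_field_derivative_def
      by (rule has_derivative_eq_rhs) (auto simp: inner_commute algebra_simps)
    then show ?thesis
      unfolding u_def by (auto intro!: derivative_eq_intros simp: algebra_simps)
  qed
  have growth: "\<bar>w s \<bullet> w' s\<bar> \<le> L * (w s \<bullet> w s)" if "a < s" "s < b" for s
  proof -
    have "\<bar>w s \<bullet> w' s\<bar> \<le> norm (w s) * norm (w' s)"
      by (rule Cauchy_Schwarz_ineq2)
    also have "\<dots> \<le> norm (w s) * (L * norm (w s))"
      by (intro mult_left_mono bound that) simp
    finally show ?thesis
      by (simp add: dot_square_norm power2_eq_square mult_ac)
  qed
  have "u (- 2 * L) b \<le> u (- 2 * L) a"
  proof (rule DERIV_nonpos_imp_decreasing_open[OF \<open>a \<le> b\<close> _ cont])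
    fix s
    assume s: "a < s" "s < b"
    have "(2 * (w s \<bullet> w' s) + - 2 * L * (w s \<bullet> w s)) * exp (- 2 * L * s) \<le> 0"
      using growth[OF s] by (intro mult_nonpos_nonneg) auto
    then show "\<exists>y. (u (- 2 * L) has_real_derivative y) (at s) \<and> y \<le> 0"
      using du[OF s] by blast
  qed
  moreover have "u (2 * L) a \<le> u (2 * L) b"
  proof (rule DERIV_nonneg_imp_increasing_open[OF \<open>a \<le> b\<close> _ cont])
    fix s
    assume s: "a < s" "s < b"
    have "0 \<le> (2 * (w s \<bullet> w' s) + 2 * L * (w s \<bullet> w s)) * exp (2 * L * s)"
      using growth[OF s] by (intro mult_nonneg_nonneg) auto
    then show "\<exists>y. (u (2 * L) has_real_derivative y) (at s) \<and> 0 \<le> y"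
      using du[OF s] by blast
  qed
  ultimately have "(w b \<bullet> w b) * exp (- 2 * L * b) \<le> (w a \<bullet> w a) * exp (- 2 * L * a)"
    "(w a \<bullet> w a) * exp (2 * L * a) \<le> (w b \<bullet> w b) * exp (2 * L * b)"
    unfolding u_def by simp_all
  then have "w a \<bullet> w a = 0 \<Longrightarrow> w b \<bullet> w b \<le> 0" "w b \<bullet> w b = 0 \<Longrightarrow> w a \<bullet> w a \<le> 0"
    by (simp_all add: mult_le_0_iff)
  then show ?thesis
    by (metis antisym inner_eq_zero_iff inner_ge_zero)
qed simp

section \<open>Solutions of coercive linear equations depending on a parameter\<close>

lemma C1_on_imp_locally_lipschitz:
  assumes "C1_on S f" "open S" "y \<in> S"
  shows "\<exists>r>0. ball y r \<subseteq> S \<and> (\<exists>M. M-lipschitz_on (ball y r) f)"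
proof -
  obtain f' where f': "\<And>z. z \<in> S \<Longrightarrow> (f has_derivative blinfun_apply (f' z)) (at z)" "continuous_on S f'"
    using assms(1) unfolding C1_on_def by blast
  have "isCont f' y"
    using assms(2,3) f'(2) continuous_on_eq_continuous_at by blast
  then obtain d where d: "d > 0" "\<And>z. dist z y < d \<Longrightarrow> dist (f' z) (f' y) < 1"
    unfolding continuous_at_eps_delta by (metis zero_less_one)
  obtain e where e: "e > 0" "ball y e \<subseteq> S"
    using assms(2,3) open_contains_ball by blast
  define r where "r = min d e"
  have "(norm (f' y) + 1)-lipschitz_on (ball y r) f"
  proof (rule lipschitz_onI)
    fix u v
    assume uv: "u \<in> ball y r" "v \<in> ball y r"
    have "norm (f u - f v) \<le> (norm (f' y) + 1) * norm (u - v)"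
    proof (rule differentiable_bound[OF convex_ball _ _ uv])
      fix z
      assume z: "z \<in> ball y r"
      then have "z \<in> S"
        using e unfolding r_def by auto
      then show "(f has_derivative blinfun_apply (f' z)) (at z within ball y r)"
        using f'(1) has_derivative_at_withinI by blast
      have "norm (f' z - f' y) < 1"
        using d(2)[of z] z unfolding r_def by (simp add: dist_norm norm_minus_commute)
      then show "onorm (blinfun_apply (f' z)) \<le> norm (f' y) + 1"
        using norm_triangle_ineq2[of "f' z" "f' y"] by (simp add: norm_blinfun.rep_eq)
    qed
    then show "dist (f u) (f v) \<le> (norm (f' y) + 1) * dist u v"
      by (simp add: dist_norm)
  qed simp
  then show ?thesis
    using d(1) e by (intro exI[of _ r]) (auto simp: r_def)
qed

text \<open>
  Near \<open>y0\<close> the forms \<open>G y\<close> are coercive with the common constant \<open>\<kappa> / 2\<close>, whence \<open>F\<close> is bounded by some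
  \<open>K\<close>.  For \<open>h = F y - F z\<close> the identity \<open>G y h h = (D y - D z) h + (G z - G y) (F z) h\<close> then bounds
  \<open>\<kappa> / 2 \<parallel>h\<parallel>\<^sup>2\<close> by a multiple of \<open>\<parallel>y - z\<parallel> \<parallel>h\<parallel>\<close>.
\<close>

lemma coercive_solution_locally_lipschitz:
  fixes G :: "'h::real_normed_vector \<Rightarrow> 'h \<Rightarrow>\<^sub>L 'h \<Rightarrow>\<^sub>L real" and D :: "'h \<Rightarrow> 'h \<Rightarrow>\<^sub>L real"
  assumes "open S" "y0 \<in> S" and G: "C1_on S G"
    and D: "0 < rD" "LD-lipschitz_on (ball y0 rD \<inter> S) D"
    and \<kappa>: "0 < \<kappa>" "\<And>v. \<kappa> * (norm v)\<^sup>2 \<le> G y0 v v"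
    and F: "\<And>y h. y \<in> S \<Longrightarrow> G y (F y) h = D y h"
  shows "\<exists>r>0. cball y0 r \<subseteq> S \<and> (\<exists>L. L-lipschitz_on (cball y0 r) F)"
proof -
  obtain rG M where rG: "0 < rG" "ball y0 rG \<subseteq> S" and M: "M-lipschitz_on (ball y0 rG) G"
    using C1_on_imp_locally_lipschitz[OF G assms(1,2)] by blast
  have "0 \<le> M" "0 \<le> LD"
    using M D(2) lipschitz_on_nonneg by blast+
  \<comment> \<open>The form \<open>G\<close> changes by at most \<open>\<kappa> / 2\<close> within distance \<open>q\<close> of \<open>y0\<close>.\<close>
  define q where "q = \<kappa> / (2 * (M + 1))"
  have "0 < q" "M * q \<le> \<kappa> / 2"
    unfolding q_def using \<kappa>(1) \<open>0 \<le> M\<close> by (simp_all add: field_simps)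
  define r where "r = min (min rD rG) q / 2"
  have r: "0 < r" "r < rD" "r < rG" "M * r \<le> \<kappa> / 2"
  proof -
    show "0 < r" "r < rD" "r < rG"
      unfolding r_def using D(1) rG(1) \<open>0 < q\<close> by auto
    have "M * r \<le> M * q"
      unfolding r_def using D(1) rG(1) \<open>0 < q\<close> \<open>0 \<le> M\<close> by (intro mult_left_mono) auto
    also have "\<dots> \<le> \<kappa> / 2"
      by fact
    finally show "M * r \<le> \<kappa> / 2" .
  qed
  have sub: "cball y0 r \<subseteq> ball y0 rD" "cball y0 r \<subseteq> ball y0 rG" "cball y0 r \<subseteq> S"
    using r rG(2) by (auto simp: subset_iff)
  have lip_D: "norm (D y - D z) \<le> LD * norm (y - z)" and lip_G: "norm (G y - G z) \<le> M * norm (y - z)"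
    if "y \<in> cball y0 r" "z \<in> cball y0 r" for y z
  proof -
    have "y \<in> ball y0 rD \<inter> S" "z \<in> ball y0 rD \<inter> S" "y \<in> ball y0 rG" "z \<in> ball y0 rG"
      using that sub by blast+
    then show "norm (D y - D z) \<le> LD * norm (y - z)" "norm (G y - G z) \<le> M * norm (y - z)"
      using lipschitz_onD[OF D(2), of y z] lipschitz_onD[OF M, of y z] by (simp_all add: dist_norm)
  qed
  have y0: "y0 \<in> cball y0 r"
    using r(1) by simp
  have norm2: "B u v \<le> norm B * norm u * norm v" for B :: "'h \<Rightarrow>\<^sub>L 'h \<Rightarrow>\<^sub>L real" and u v
  proof -
    have "B u v \<le> norm (B u) * norm v"
      using norm_blinfun[of "B u" v] by simp
    also have "\<dots> \<le> norm B * norm u * norm v"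
      by (intro mult_right_mono norm_blinfun) simp
    finally show ?thesis .
  qed
  have norm1: "f v \<le> norm f * norm v" for f :: "'h \<Rightarrow>\<^sub>L real" and v
    using norm_blinfun[of f v] by simp
  have coercive: "\<kappa> / 2 * (norm v)\<^sup>2 \<le> G y v v" if y: "y \<in> cball y0 r" for y v
  proof -
    have "norm (G y0 - G y) \<le> M * norm (y0 - y)"
      using lip_G[OF y0 y] .
    also have "\<dots> \<le> M * r"
      using y \<open>0 \<le> M\<close> by (intro mult_left_mono) (auto simp: dist_norm)
    also have "\<dots> \<le> \<kappa> / 2"
      by (rule r(4))
    finally have "norm (G y0 - G y) * (norm v)\<^sup>2 \<le> \<kappa> / 2 * (norm v)\<^sup>2"
      by (intro mult_right_mono) auto
    moreover have "G y0 v v - G y v v \<le> norm (G y0 - G y) * (norm v)\<^sup>2"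
      using norm2[of "G y0 - G y" v v] by (simp add: blinfun.diff_left power2_eq_square mult.assoc)
    ultimately show ?thesis
      using \<kappa>(2)[of v] by linarith
  qed
  have cancel: "norm v \<le> b * 2 / \<kappa>" if "\<kappa> / 2 * (norm v)\<^sup>2 \<le> b * norm v" "0 \<le> b" for v :: 'h and b
  proof (cases "v = 0")
    case False
    then have "\<kappa> / 2 * norm v \<le> b"
      using that(1) by (simp add: power2_eq_square)
    then show ?thesis
      using \<kappa>(1) by (simp add: field_simps)
  qed (use that \<kappa> in simp)
  define K where "K = (norm (D y0) + LD * r) * 2 / \<kappa>"
  have K: "norm (F y) \<le> K" if y: "y \<in> cball y0 r" for y
    unfolding K_def
  proof (rule cancel)
    have "norm (D y - D y0) \<le> LD * r"
      using lip_D[OF y y0] y \<open>0 \<le> LD\<close>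
      by (smt (verit) dist_norm dist_commute mem_cball mult_left_mono)
    then have "norm (D y) \<le> norm (D y0) + LD * r"
      using norm_triangle_ineq2[of "D y" "D y0"] by linarith
    then have "norm (D y) * norm (F y) \<le> (norm (D y0) + LD * r) * norm (F y)"
      by (rule mult_right_mono) simp
    moreover have "\<kappa> / 2 * (norm (F y))\<^sup>2 \<le> norm (D y) * norm (F y)"
      using coercive[OF y, of "F y"] F[of y "F y"] norm1[of "D y" "F y"] y sub(3) by auto
    ultimately show "\<kappa> / 2 * (norm (F y))\<^sup>2 \<le> (norm (D y0) + LD * r) * norm (F y)"
      by linarith
  qed (use \<open>0 \<le> LD\<close> r in simp)
  have "0 \<le> K"
    using K[OF y0] norm_ge_zero order_trans by blast
  have "((LD + M * K) * 2 / \<kappa>)-lipschitz_on (cball y0 r) F"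
  proof (rule lipschitz_onI)
    fix y z
    assume y: "y \<in> cball y0 r" and z: "z \<in> cball y0 r"
    define h where "h = F y - F z"
    have "norm h \<le> (LD + M * K) * norm (y - z) * 2 / \<kappa>"
    proof (rule cancel)
      have "\<kappa> / 2 * (norm h)\<^sup>2 \<le> G y h h"
        using y by (rule coercive)
      also have "G y h h = (D y - D z) h + (G z - G y) (F z) h"
      proof -
        have "G y (F y) h = D y h" "G z (F z) h = D z h"
          using F y z sub(3) by blast+
        then have "G y (F y) h - G y (F z) h = (D y - D z) h + (G z - G y) (F z) h"
          by (simp add: blinfun.diff_left)
        then show ?thesis
          by (simp add: h_def blinfun.diff_left blinfun.diff_right)
      qed
      also have "\<dots> \<le> LD * norm (y - z) * norm h + M * norm (y - z) * K * norm h"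
      proof (rule add_mono)
        show "(D y - D z) h \<le> LD * norm (y - z) * norm h"
          using norm1[of "D y - D z" h] mult_right_mono[OF lip_D[OF y z], of "norm h"] by simp
        have "norm (G z - G y) * norm (F z) \<le> M * norm (y - z) * K"
          using lip_G[OF z y] K[OF z] \<open>0 \<le> M\<close> by (intro mult_mono) (auto simp: norm_minus_commute)
        then have "norm (G z - G y) * norm (F z) * norm h \<le> M * norm (y - z) * K * norm h"
          by (rule mult_right_mono) simp
        then show "(G z - G y) (F z) h \<le> M * norm (y - z) * K * norm h"
          using norm2[of "G z - G y" "F z" h] by linarith
      qed
      also have "\<dots> = (LD + M * K) * norm (y - z) * norm h"
        by (simp add: algebra_simps)
      finally show "\<kappa> / 2 * (norm h)\<^sup>2 \<le> (LD + M * K) * norm (y - z) * norm h" .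
    qed (use \<open>0 \<le> LD\<close> \<open>0 \<le> M\<close> \<open>0 \<le> K\<close> in simp)
    also have "\<dots> = (LD + M * K) * 2 / \<kappa> * norm (y - z)"
      by simp
    finally show "dist (F y) (F z) \<le> (LD + M * K) * 2 / \<kappa> * dist y z"
      by (simp only: h_def dist_norm)
  qed (use \<open>0 \<le> LD\<close> \<open>0 \<le> M\<close> \<open>0 \<le> K\<close> \<kappa>(1) in simp)
  then show ?thesis
    using r(1) sub(3) by blast
qed

lemma form_Cauchy_Schwarz:
  fixes B :: "'h::real_normed_vector \<Rightarrow>\<^sub>L 'h \<Rightarrow>\<^sub>L real"
  assumes sym: "\<And>u v. B u v = B v u" and pos: "\<And>v. v \<noteq> 0 \<Longrightarrow> 0 < B v v"
  shows "(B u v)\<^sup>2 \<le> B u u * B v v"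
proof (cases "v = 0")
  case True
  then show ?thesis
    by (simp add: blinfun.bilinear_simps)
next
  case False
  then have "0 < B v v"
    by (rule pos)
  define r where "r = B u v / B v v"
  have "0 \<le> B (u - r *\<^sub>R v) (u - r *\<^sub>R v)"
    using pos[of "u - r *\<^sub>R v"] by (cases "u - r *\<^sub>R v = 0") (auto simp: blinfun.bilinear_simps)
  also have "\<dots> = B u u - (B u v)\<^sup>2 / B v v"
    using \<open>0 < B v v\<close> unfolding r_def
    by (simp add: blinfun.bilinear_simps sym[of v u] field_simps power2_eq_square)
  finally show ?thesis
    using \<open>0 < B v v\<close> by (simp add: field_simps)
qed

section \<open>Tangent spaces in charts and the gradient\<close>

locale energy_manifold =
  fixes A :: "('m::t2_space, 'h::{real_inner,complete_space}) chart set"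
    and g :: "('m, 'h) metric_tensor"
    and E :: "'m \<Rightarrow> real"
  assumes manifold: "riemannian_manifold A g" and regular: "C11_loc_energy A E"
begin

lemma obtain_chart: obtains c where "c \<in> A" "x \<in> cdom c"
  using manifold unfolding riemannian_manifold_def C2_atlas_def by (metis UNIV_I UN_E)

lemma
  assumes "c \<in> A"
  shows open_cdom: "open (cdom c)"
    and open_chart_image: "open (cmap c ` cdom c)"
    and continuous_cmap: "continuous_on (cdom c) (cmap c)"
    and continuous_cinv: "continuous_on (cmap c ` cdom c) (cinv c)"
    and cinv_cmap: "x \<in> cdom c \<Longrightarrow> cinv c (cmap c x) = x"
    and cmap_cinv: "y \<in> cmap c ` cdom c \<Longrightarrow> cmap c (cinv c y) = y"
    and cinv_in_cdom: "y \<in> cmap c ` cdom c \<Longrightarrow> cinv c y \<in> cdom c"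
  using assms manifold unfolding riemannian_manifold_def C2_atlas_def homeomorphism_def by auto

lemma open_overlap:
  assumes "c \<in> A" "open W"
  shows "open (cmap c ` (cdom c \<inter> W))"
proof -
  have "cmap c ` (cdom c \<inter> W) = cmap c ` cdom c \<inter> cinv c -` W"
    using cinv_cmap[OF assms(1)] by force
  then show ?thesis
    using continuous_open_preimage[OF continuous_cinv[OF assms(1)] open_chart_image[OF assms(1)] assms(2)]
    by simp
qed

lemma transition_cmap: "c \<in> A \<Longrightarrow> x \<in> cdom c \<Longrightarrow> transition c d (cmap c x) = cmap d x"
  by (simp add: transition_def cinv_cmap)

lemma transition_has_derivative:
  assumes "c \<in> A" "d \<in> A" "x \<in> cdom c" "x \<in> cdom d"
  shows "(transition c d has_derivative frechet_derivative (transition c d) (at (cmap c x))) (at (cmap c x))"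
proof -
  have "C2_on (cmap c ` (cdom c \<inter> cdom d)) (transition c d)"
    using assms manifold unfolding riemannian_manifold_def C2_atlas_def by blast
  then have "transition c d differentiable (at (cmap c x))"
    using assms unfolding C2_on_def differentiable_def by blast
  then show ?thesis
    using frechet_derivative_works by blast
qed

lemma transition_derivative_cocycle:
  assumes "c \<in> A" "d \<in> A" "e \<in> A" "x \<in> cdom c" "x \<in> cdom d" "x \<in> cdom e"
  shows "frechet_derivative (transition d e) (at (cmap d x))
           (frechet_derivative (transition c d) (at (cmap c x)) u)
         = frechet_derivative (transition c e) (at (cmap c x)) u"
proof -
  have "((transition d e \<circ> transition c d) has_derivative
      (frechet_derivative (transition d e) (at (cmap d x)) \<circ> frechet_derivative (transition c d) (at (cmap c x))))
      (at (cmap c x))"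
    using assms transition_has_derivative[of d e x] transition_has_derivative[of c d x]
    by (intro diff_chain_at) (simp_all add: transition_cmap)
  then have "(transition c e has_derivative
      (frechet_derivative (transition d e) (at (cmap d x)) \<circ> frechet_derivative (transition c d) (at (cmap c x))))
      (at (cmap c x))"
  proof (rule has_derivative_transform_within_open)
    show "open (cmap c ` (cdom c \<inter> cdom d))"
      using open_overlap open_cdom assms by blast
  qed (use assms in \<open>auto simp: transition_cmap\<close>)
  then show ?thesis
    using frechet_derivative_at by (metis comp_apply)
qed

lemma transition_derivative_refl:
  assumes "c \<in> A" "x \<in> cdom c"
  shows "frechet_derivative (transition c c) (at (cmap c x)) u = u"
proof -
  have "((\<lambda>y. y) has_derivative (\<lambda>u. u)) (at (cmap c x))"
    by simp
  then have "(transition c c has_derivative (\<lambda>u. u)) (at (cmap c x))"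
    by (rule has_derivative_transform_within_open[OF _ open_chart_image[OF assms(1)]])
      (use assms in \<open>auto simp: transition_cmap\<close>)
  then show ?thesis
    using frechet_derivative_at by metis
qed

text \<open>
  The inverse of \<open>v \<mapsto> v c\<close>: for each chart \<open>c\<close> around \<open>x\<close> it identifies the model space with the tangent
  space at \<open>x\<close>.
\<close>

definition tangent_of :: "('m, 'h) chart \<Rightarrow> 'm \<Rightarrow> 'h \<Rightarrow> ('m, 'h) tangent" where
  "tangent_of c x u =
     (\<lambda>d. if d \<in> A \<and> x \<in> cdom d then frechet_derivative (transition c d) (at (cmap c x)) u else 0)"

lemma tangent_of_in_tangent_space:
  assumes "c \<in> A" "x \<in> cdom c"
  shows "tangent_of c x u \<in> tangent_space A x"
  unfolding tangent_space_def tangent_of_def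
  using assms transition_derivative_cocycle by auto

lemma tangent_of_same_chart: "c \<in> A \<Longrightarrow> x \<in> cdom c \<Longrightarrow> tangent_of c x u c = u"
  unfolding tangent_of_def by (simp add: transition_derivative_refl)

lemma tangent_transition:
  assumes "v \<in> tangent_space A x" "c \<in> A" "x \<in> cdom c" "d \<in> A" "x \<in> cdom d"
  shows "v d = frechet_derivative (transition c d) (at (cmap c x)) (v c)"
  using assms unfolding tangent_space_def by blast

lemma tangent_of_component:
  assumes "c \<in> A" "x \<in> cdom c" "v \<in> tangent_space A x"
  shows "tangent_of c x (v c) = v"
proof
  fix d
  have "\<And>d. \<not> (d \<in> A \<and> x \<in> cdom d) \<Longrightarrow> v d = 0"
    using assms(3) unfolding tangent_space_def by blast
  then show "tangent_of c x (v c) d = v d"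
    using tangent_transition[OF assms(3,1,2)] unfolding tangent_of_def by simp
qed

lemma tangent_space_zero: "(\<lambda>_. 0) \<in> tangent_space A x"
proof -
  obtain c where c: "c \<in> A" "x \<in> cdom c"
    by (rule obtain_chart)
  have "tangent_of c x 0 = (\<lambda>_. 0)"
  proof
    show "tangent_of c x 0 d = 0" for d
      unfolding tangent_of_def using linear_0[OF has_derivative_linear[OF transition_has_derivative, of c d x]] c
      by simp
  qed
  then show ?thesis
    using tangent_of_in_tangent_space[OF c] by metis
qed

text \<open>
  Since \<open>v \<mapsto> v c\<close> maps the tangent space onto the whole model space, the symmetry of \<open>g x\<close> and the lower
  norm bound hold for the coordinate form \<open>G\<close> on all vectors of the model space.
\<close>

lemma obtain_chart_metric:
  assumes c: "c \<in> A"
  obtains G :: "'h \<Rightarrow> 'h \<Rightarrow>\<^sub>L 'h \<Rightarrow>\<^sub>L real" where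
    "C1_on (cmap c ` cdom c) G"
    "\<And>x v w. x \<in> cdom c \<Longrightarrow> v \<in> tangent_space A x \<Longrightarrow> w \<in> tangent_space A x \<Longrightarrow>
       g x v w = G (cmap c x) (v c) (w c)"
    "\<And>x u v. x \<in> cdom c \<Longrightarrow> G (cmap c x) u v = G (cmap c x) v u"
    "\<And>x. x \<in> cdom c \<Longrightarrow> \<exists>\<kappa>>0. \<forall>v. \<kappa> * (norm v)\<^sup>2 \<le> G (cmap c x) v v"
proof -
  have metric: "strong_C1_metric A g"
    using manifold unfolding riemannian_manifold_def by blast
  then obtain G :: "'h \<Rightarrow> 'h \<Rightarrow>\<^sub>L 'h \<Rightarrow>\<^sub>L real" where
    G: "C1_on (cmap c ` cdom c) G" and
    gG: "\<And>x v w. x \<in> cdom c \<Longrightarrow> v \<in> tangent_space A x \<Longrightarrow> w \<in> tangent_space A x \<Longrightarrow>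
       g x v w = G (cmap c x) (v c) (w c)"
    using c unfolding strong_C1_metric_def by meson
  have G_tangent: "G (cmap c x) u v = g x (tangent_of c x u) (tangent_of c x v)" if "x \<in> cdom c" for x u v
    using gG[OF that tangent_of_in_tangent_space tangent_of_in_tangent_space] c that
    by (simp add: tangent_of_same_chart)
  show thesis
  proof (rule that[OF G gG])
    fix x u v
    assume x: "x \<in> cdom c"
    have ip: "inner_product_on (tangent_space A x) (g x)"
      using metric unfolding strong_C1_metric_def by blast
    show "G (cmap c x) u v = G (cmap c x) v u"
      unfolding G_tangent[OF x] using ip tangent_of_in_tangent_space[OF c x]
      unfolding inner_product_on_def by blast
    obtain a where a: "a > 0" "\<And>v. v \<in> tangent_space A x \<Longrightarrow> a * norm (v c) \<le> tnorm g x v"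
      using metric c x unfolding strong_C1_metric_def by meson
    have "a\<^sup>2 * (norm v)\<^sup>2 \<le> G (cmap c x) v v" for v
    proof -
      have t: "tangent_of c x v \<in> tangent_space A x"
        using c x by (rule tangent_of_in_tangent_space)
      have "0 \<le> G (cmap c x) v v"
      proof (cases "tangent_of c x v = (\<lambda>_. 0)")
        case True
        then have "v = 0"
          using tangent_of_same_chart[OF c x, of v] by simp
        then show ?thesis
          by (simp add: blinfun.bilinear_simps)
      next
        case False
        then show ?thesis
          using ip t unfolding inner_product_on_def G_tangent[OF x] by (simp add: less_imp_le)
      qed
      moreover have "a * norm v \<le> sqrt (G (cmap c x) v v)"
        using a(2)[OF t] unfolding tnorm_def G_tangent[OF x] by (simp add: tangent_of_same_chart c x)
      ultimately show ?thesis
        using a(1) by (metis norm_ge_zero mult_nonneg_nonneg less_imp_le power_mono power_mult_distrib real_sqrt_pow2)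
    qed
    then show "\<exists>\<kappa>>0. \<forall>v. \<kappa> * (norm v)\<^sup>2 \<le> G (cmap c x) v v"
      using a(1) by (intro exI[of _ "a\<^sup>2"]) auto
  qed
qed

text \<open>
  By the chain rule, the differential can be computed in any chart around \<open>x\<close>, although it is defined
  through an arbitrary one.
\<close>

lemma obtain_chart_differential:
  assumes c: "c \<in> A"
  obtains D :: "'h \<Rightarrow> 'h \<Rightarrow>\<^sub>L real" where
    "\<And>x. x \<in> cdom c \<Longrightarrow> ((E \<circ> cinv c) has_derivative D (cmap c x)) (at (cmap c x))"
    "\<And>x. x \<in> cdom c \<Longrightarrow> \<exists>r>0. \<exists>L. L-lipschitz_on (ball (cmap c x) r \<inter> cmap c ` cdom c) D"
    "\<And>x h. x \<in> cdom c \<Longrightarrow> h \<in> tangent_space A x \<Longrightarrow> differential A E x h = D (cmap c x) (h c)"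
proof -
  obtain D :: "'h \<Rightarrow> 'h \<Rightarrow>\<^sub>L real" where
    D: "\<And>x. x \<in> cdom c \<Longrightarrow> ((E \<circ> cinv c) has_derivative D (cmap c x)) (at (cmap c x))" and
    lip: "\<And>x. x \<in> cdom c \<Longrightarrow> \<exists>r>0. \<exists>L. L-lipschitz_on (ball (cmap c x) r \<inter> cmap c ` cdom c) D"
    using regular c unfolding C11_loc_energy_def C11_loc_on_def by (metis imageI)
  show thesis
  proof (rule that[OF D lip])
    fix x h
    assume x: "x \<in> cdom c" and h: "h \<in> tangent_space A x"
    define d where "d = (SOME c. c \<in> A \<and> x \<in> cdom c)"
    have d: "d \<in> A" "x \<in> cdom d"
      using c x someI[of "\<lambda>c. c \<in> A \<and> x \<in> cdom c" c] unfolding d_def by auto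
    have "((E \<circ> cinv c) \<circ> transition d c has_derivative
        blinfun_apply (D (cmap c x)) \<circ> frechet_derivative (transition d c) (at (cmap d x))) (at (cmap d x))"
      using D[OF x] transition_has_derivative[OF d(1) c d(2) x]
      by (intro diff_chain_at) (simp_all add: transition_cmap d)
    then have "((E \<circ> cinv d) has_derivative
        blinfun_apply (D (cmap c x)) \<circ> frechet_derivative (transition d c) (at (cmap d x))) (at (cmap d x))"
    proof (rule has_derivative_transform_within_open)
      show "open (cmap d ` (cdom d \<inter> cdom c))"
        using open_overlap open_cdom c d by blast
    qed (use d x in \<open>auto simp: transition_cmap cinv_cmap c\<close>)
    then have "frechet_derivative (E \<circ> cinv d) (at (cmap d x))
        = blinfun_apply (D (cmap c x)) \<circ> frechet_derivative (transition d c) (at (cmap d x))"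
      using frechet_derivative_at by metis
    then show "differential A E x h = D (cmap c x) (h c)"
      unfolding differential_def Let_def d_def[symmetric]
      using tangent_transition[OF h d c x] by simp
  qed
qed

text \<open>
  Lax--Milgram solves the defining equation of the gradient in one chart, and \<open>tangent_of\<close> turns the
  solution into a tangent vector.
\<close>

lemma
  shows gradient_in_tangent_space: "gradient A g E x \<in> tangent_space A x"
    and differential_eq_gradient: "h \<in> tangent_space A x \<Longrightarrow> differential A E x h = g x (gradient A g E x) h"
proof -
  obtain c where c: "c \<in> A" "x \<in> cdom c"
    by (rule obtain_chart)
  obtain G where G: "\<And>v w. v \<in> tangent_space A x \<Longrightarrow> w \<in> tangent_space A x \<Longrightarrow>
       g x v w = blinfun_apply (blinfun_apply (G (cmap c x)) (v c)) (w c)"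
     "\<And>u v. blinfun_apply (blinfun_apply (G (cmap c x)) u) v = G (cmap c x) v u"
     "\<exists>\<kappa>>0. \<forall>v. \<kappa> * (norm v)\<^sup>2 \<le> G (cmap c x) v v"
    using obtain_chart_metric[OF c(1)] c(2) by metis
  obtain D where D: "\<And>h. h \<in> tangent_space A x \<Longrightarrow> differential A E x h = blinfun_apply (D (cmap c x)) (h c)"
    using obtain_chart_differential[OF c(1)] c(2) by metis
  obtain \<kappa> where \<kappa>: "\<kappa> > 0" "\<And>v. \<kappa> * (norm v)\<^sup>2 \<le> G (cmap c x) v v"
    using G(3) by blast
  obtain u where u: "\<And>h. G (cmap c x) u h = D (cmap c x) h"
    using lax_milgram_symmetric[of "G (cmap c x)" \<kappa> "D (cmap c x)"] G(2) \<kappa> by blast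
  have "\<exists>!v. v \<in> tangent_space A x \<and> (\<forall>h\<in>tangent_space A x. differential A E x h = g x v h)"
  proof
    show "tangent_of c x u \<in> tangent_space A x \<and>
        (\<forall>h\<in>tangent_space A x. differential A E x h = g x (tangent_of c x u) h)"
      using tangent_of_in_tangent_space[OF c] by (auto simp: G(1) D tangent_of_same_chart c u)
    fix v
    assume v: "v \<in> tangent_space A x \<and> (\<forall>h\<in>tangent_space A x. differential A E x h = g x v h)"
    have "G (cmap c x) (v c) h = G (cmap c x) u h" for h
      using v tangent_of_in_tangent_space[OF c, of h] by (auto simp: G(1) D tangent_of_same_chart c u)
    then have "G (cmap c x) (v c - u) (v c - u) = 0"
      by (simp add: blinfun.bilinear_simps)
    then have "v c = u"
      using \<kappa>(1) \<kappa>(2)[of "v c - u"] by (simp add: mult_le_0_iff)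
    then show "v = tangent_of c x u"
      using tangent_of_component[OF c] v by metis
  qed
  from theI'[OF this] show "gradient A g E x \<in> tangent_space A x"
    "h \<in> tangent_space A x \<Longrightarrow> differential A E x h = g x (gradient A g E x) h"
    unfolding gradient_def by blast+
qed

lemma gradient_chart_equation:
  assumes "c \<in> A" "x \<in> cdom c"
    and "\<And>v w. v \<in> tangent_space A x \<Longrightarrow> w \<in> tangent_space A x \<Longrightarrow> g x v w = G (v c) (w c)"
    and "\<And>h. h \<in> tangent_space A x \<Longrightarrow> differential A E x h = D (h c)"
  shows "G (gradient A g E x c) h = D h"
  using differential_eq_gradient[of "tangent_of c x h" x] tangent_of_in_tangent_space[OF assms(1,2)]
  by (simp add: assms gradient_in_tangent_space tangent_of_same_chart)

lemma gradient_locally_lipschitz: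
  assumes c: "c \<in> A" and x: "x \<in> cdom c"
  shows "\<exists>r>0. cball (cmap c x) r \<subseteq> cmap c ` cdom c \<and>
    (\<exists>L. L-lipschitz_on (cball (cmap c x) r) (\<lambda>y. gradient A g E (cinv c y) c))"
proof -
  obtain G where G: "C1_on (cmap c ` cdom c) G"
    "\<And>x v w. x \<in> cdom c \<Longrightarrow> v \<in> tangent_space A x \<Longrightarrow> w \<in> tangent_space A x \<Longrightarrow>
       g x v w = blinfun_apply (blinfun_apply (G (cmap c x)) (v c)) (w c)"
    "\<exists>\<kappa>>0. \<forall>v. \<kappa> * (norm v)\<^sup>2 \<le> G (cmap c x) v v"
    using obtain_chart_metric[OF c] x by metis
  obtain D where D: "\<exists>r>0. \<exists>L. L-lipschitz_on (ball (cmap c x) r \<inter> cmap c ` cdom c) D"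
    "\<And>x h. x \<in> cdom c \<Longrightarrow> h \<in> tangent_space A x \<Longrightarrow> differential A E x h = blinfun_apply (D (cmap c x)) (h c)"
    using obtain_chart_differential[OF c] x by metis
  obtain \<kappa> where \<kappa>: "\<kappa> > 0" "\<And>v. \<kappa> * (norm v)\<^sup>2 \<le> G (cmap c x) v v"
    using G(3) by blast
  obtain r L where r: "r > 0" "L-lipschitz_on (ball (cmap c x) r \<inter> cmap c ` cdom c) D"
    using D(1) by blast
  show ?thesis
  proof (rule coercive_solution_locally_lipschitz[OF open_chart_image[OF c] _ G(1) r \<kappa>])
    show "cmap c x \<in> cmap c ` cdom c"
      using x by simp
    fix y h
    assume y: "y \<in> cmap c ` cdom c"
    show "G y (gradient A g E (cinv c y) c) h = D y h"
      using gradient_chart_equation[OF c cinv_in_cdom[OF c y], of "\<lambda>v w. G y v w" "\<lambda>h. D y h"]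
        G(2)[OF cinv_in_cdom[OF c y]] D(2)[OF cinv_in_cdom[OF c y]] by (simp add: cmap_cinv[OF c y])
  qed
qed

lemma continuous_gradient_component:
  assumes c: "c \<in> A"
  shows "continuous_on (cdom c) (\<lambda>x. gradient A g E x c)"
proof -
  have "continuous_on (cmap c ` cdom c) (\<lambda>y. gradient A g E (cinv c y) c)"
  proof (rule continuous_at_imp_continuous_on, rule ballI)
    fix y
    assume "y \<in> cmap c ` cdom c"
    then obtain x where x: "x \<in> cdom c" "y = cmap c x"
      by blast
    obtain r L where r: "r > 0" and lip: "L-lipschitz_on (cball y r) (\<lambda>y. gradient A g E (cinv c y) c)"
      using gradient_locally_lipschitz[OF c x(1)] x(2) by blast
    show "isCont (\<lambda>y. gradient A g E (cinv c y) c) y"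
      using continuous_on_subset[OF lipschitz_on_continuous_on[OF lip] ball_subset_cball] r
      by (simp add: continuous_on_eq_continuous_at)
  qed
  then have "continuous_on (cdom c) (\<lambda>x. gradient A g E (cinv c (cmap c x)) c)"
    using continuous_cmap[OF c] by (rule continuous_on_compose2) simp
  then show ?thesis
    by (rule continuous_on_eq) (simp add: cinv_cmap c)
qed

definition gradient_norm_sq :: "'m \<Rightarrow> real" where
  "gradient_norm_sq x = g x (gradient A g E x) (gradient A g E x)"

lemma continuous_gradient_norm_sq: "continuous_on UNIV gradient_norm_sq"
proof -
  have "continuous_on (\<Union>c\<in>A. cdom c) gradient_norm_sq"
  proof (rule continuous_on_open_UN)
    fix c
    assume c: "c \<in> A"
    then show "open (cdom c)"
      by (rule open_cdom)
    obtain G where G: "C1_on (cmap c ` cdom c) G"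
      "\<And>x v w. x \<in> cdom c \<Longrightarrow> v \<in> tangent_space A x \<Longrightarrow> w \<in> tangent_space A x \<Longrightarrow>
         g x v w = blinfun_apply (blinfun_apply (G (cmap c x)) (v c)) (w c)"
      using obtain_chart_metric[OF c] by metis
    have "continuous_on (cmap c ` cdom c) G"
      using G(1) unfolding C1_on_def
      by (meson continuous_at_imp_continuous_on has_derivative_continuous)
    then have "continuous_on (cdom c) (\<lambda>x. G (cmap c x))"
      using continuous_cmap[OF c] by (rule continuous_on_compose2) simp
    then have "continuous_on (cdom c) (\<lambda>x. G (cmap c x) (gradient A g E x c) (gradient A g E x c))"
      by (intro continuous_intros continuous_gradient_component c)
    then show "continuous_on (cdom c) gradient_norm_sq"
      by (rule continuous_on_eq) (simp add: gradient_norm_sq_def G(2) gradient_in_tangent_space)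
  qed
  then show ?thesis
    using manifold unfolding riemannian_manifold_def C2_atlas_def by simp
qed

text \<open>
  By the Cauchy--Schwarz inequality the dual norm of the differential is at most the norm of the gradient.
  This is what makes a sequence with gradients tending to zero and bounded energy a Palais--Smale sequence.
\<close>

lemma gradient_norm_sq_nonneg: "0 \<le> gradient_norm_sq x"
  and gradient_norm_sq_eq_0_iff: "gradient_norm_sq x = 0 \<longleftrightarrow> critical_point A E x"
  and critical_point_iff_gradient: "critical_point A E x \<longleftrightarrow> gradient A g E x = (\<lambda>_. 0)"
  and differential_norm_le: "0 \<le> differential_norm A g E x \<and> differential_norm A g E x \<le> sqrt (gradient_norm_sq x)"
proof -
  obtain c where c: "c \<in> A" "x \<in> cdom c"
    by (rule obtain_chart)
  obtain G where G: "\<And>v w. v \<in> tangent_space A x \<Longrightarrow> w \<in> tangent_space A x \<Longrightarrow>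
       g x v w = blinfun_apply (blinfun_apply (G (cmap c x)) (v c)) (w c)"
     "\<And>u v. blinfun_apply (blinfun_apply (G (cmap c x)) u) v = G (cmap c x) v u"
     "\<exists>\<kappa>>0. \<forall>v. \<kappa> * (norm v)\<^sup>2 \<le> G (cmap c x) v v"
    using obtain_chart_metric[OF c(1)] c(2) by metis
  define B where "B = G (cmap c x)"
  have B: "\<And>u v. B u v = B v u" "\<And>v w. v \<in> tangent_space A x \<Longrightarrow> w \<in> tangent_space A x \<Longrightarrow>
       g x v w = B (v c) (w c)"
    unfolding B_def by (fact G)+
  obtain \<kappa> where \<kappa>: "\<kappa> > 0" "\<And>v. \<kappa> * (norm v)\<^sup>2 \<le> B v v"
    using G(3) unfolding B_def by blast
  have pos: "0 < B v v" if "v \<noteq> 0" for v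
    using \<kappa>(1) \<kappa>(2)[of v] that by (smt (verit) zero_less_mult_iff zero_less_norm_iff zero_less_power)
  let ?n = "gradient A g E x"
  have n: "?n \<in> tangent_space A x"
    by (rule gradient_in_tangent_space)
  have slope: "gradient_norm_sq x = B (?n c) (?n c)"
    unfolding gradient_norm_sq_def by (simp add: B n)
  show nonneg: "0 \<le> gradient_norm_sq x"
    unfolding slope using pos[of "?n c"] by (cases "?n c = 0") auto
  have zero: "gradient_norm_sq x = 0 \<Longrightarrow> ?n = (\<lambda>_. 0)"
    using pos[of "?n c"] tangent_of_component[OF c n] tangent_of_component[OF c tangent_space_zero]
    unfolding slope by (metis less_irrefl)
  have zero': "?n = (\<lambda>_. 0) \<Longrightarrow> critical_point A E x"
    unfolding critical_point_def
    using tangent_space_zero by (simp add: differential_eq_gradient B)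
  have crit: "critical_point A E x \<Longrightarrow> gradient_norm_sq x = 0"
    unfolding critical_point_def gradient_norm_sq_def using n differential_eq_gradient[OF n] by simp
  show "gradient_norm_sq x = 0 \<longleftrightarrow> critical_point A E x" "critical_point A E x \<longleftrightarrow> ?n = (\<lambda>_. 0)"
    using zero zero' crit by blast+
  define S where "S = {h \<in> tangent_space A x. tnorm g x h \<le> 1}"
  have S0: "(\<lambda>_. 0) \<in> S"
    unfolding S_def tnorm_def using tangent_space_zero by (simp add: B)
  have bound: "\<bar>differential A E x h\<bar> \<le> sqrt (gradient_norm_sq x)" if "h \<in> S" for h
  proof (rule real_le_rsqrt)
    have h: "h \<in> tangent_space A x" "B (h c) (h c) \<le> 1"
      using that unfolding S_def tnorm_def by (auto simp: B)
    have "\<bar>differential A E x h\<bar>\<^sup>2 \<le> B (?n c) (?n c) * B (h c) (h c)"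
      using form_Cauchy_Schwarz[of B "?n c" "h c"] B(1) pos h(1) by (simp add: differential_eq_gradient B(2) n)
    also have "\<dots> \<le> gradient_norm_sq x"
      using mult_left_mono[OF h(2) nonneg] unfolding slope by simp
    finally show "\<bar>differential A E x h\<bar>\<^sup>2 \<le> gradient_norm_sq x" .
  qed
  show "0 \<le> differential_norm A g E x \<and> differential_norm A g E x \<le> sqrt (gradient_norm_sq x)"
    unfolding differential_norm_def S_def[symmetric]
  proof
    show "(SUP h\<in>S. \<bar>differential A E x h\<bar>) \<le> sqrt (gradient_norm_sq x)"
      using S0 bound by (intro cSUP_least) auto
    have "\<bar>differential A E x (\<lambda>_. 0)\<bar> \<le> (SUP h\<in>S. \<bar>differential A E x h\<bar>)"
      using bound by (intro cSUP_upper S0 bdd_aboveI2) auto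
    then show "0 \<le> (SUP h\<in>S. \<bar>differential A E x h\<bar>)"
      by linarith
  qed
qed

section \<open>Integral curves of the negative gradient\<close>

text \<open>
  Integral curves of \<open>- \<nabla>E\<close> on an arbitrary set of times \<open>I\<close>.  The differential equation is required in
  every chart; \<open>descent_curveI\<close> reduces this to one chart at each time.
\<close>

definition descent_curve :: "real set \<Rightarrow> (real \<Rightarrow> 'm) \<Rightarrow> bool" where
  "descent_curve I \<gamma> \<longleftrightarrow> continuous_on I \<gamma> \<and>
     (\<forall>t\<in>I. \<forall>c\<in>A. \<gamma> t \<in> cdom c \<longrightarrow>
        ((cmap c \<circ> \<gamma>) has_vector_derivative - gradient A g E (\<gamma> t) c) (at t within I))"

lemma descent_curve_continuous: "descent_curve I \<gamma> \<Longrightarrow> continuous_on I \<gamma>"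
  and descent_curve_derivative: "descent_curve I \<gamma> \<Longrightarrow> t \<in> I \<Longrightarrow> c \<in> A \<Longrightarrow> \<gamma> t \<in> cdom c \<Longrightarrow>
    ((cmap c \<circ> \<gamma>) has_vector_derivative - gradient A g E (\<gamma> t) c) (at t within I)"
  unfolding descent_curve_def by blast+

lemma descent_curve_subset: "descent_curve I \<gamma> \<Longrightarrow> J \<subseteq> I \<Longrightarrow> descent_curve J \<gamma>"
  unfolding descent_curve_def
  by (meson continuous_on_subset has_vector_derivative_within_subset subsetD)

lemma eventually_in_open:
  assumes "continuous_on I \<gamma>" "t \<in> I" "open W" "\<gamma> t \<in> W"
  obtains \<epsilon> :: real where "\<epsilon> > 0" "\<And>s. s \<in> I \<Longrightarrow> \<bar>s - t\<bar> < \<epsilon> \<Longrightarrow> \<gamma> s \<in> W"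
proof -
  have "(\<gamma> \<longlongrightarrow> \<gamma> t) (at t within I)"
    using assms(1,2) by (simp add: continuous_on_def)
  then have "eventually (\<lambda>s. \<gamma> s \<in> W) (at t within I)"
    using assms(3,4) by (rule topological_tendstoD)
  then obtain \<epsilon> where "\<epsilon> > 0" "\<And>s. s \<in> I \<Longrightarrow> s \<noteq> t \<Longrightarrow> dist s t < \<epsilon> \<Longrightarrow> \<gamma> s \<in> W"
    unfolding eventually_at by blast
  then show thesis
    using that[of \<epsilon>] assms(4) by (metis dist_real_def)
qed

lemma curve_derivative_change_chart:
  assumes \<gamma>: "continuous_on I \<gamma>" "t \<in> I" and cd: "c \<in> A" "d \<in> A" "\<gamma> t \<in> cdom c" "\<gamma> t \<in> cdom d"
    and deriv: "((cmap c \<circ> \<gamma>) has_vector_derivative u) (at t within I)"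
  shows "((cmap d \<circ> \<gamma>) has_vector_derivative
           frechet_derivative (transition c d) (at (cmap c (\<gamma> t))) u) (at t within I)"
proof -
  let ?T = "frechet_derivative (transition c d) (at (cmap c (\<gamma> t)))"
  have T: "(transition c d has_derivative ?T) (at (cmap c (\<gamma> t)))"
    using transition_has_derivative cd by blast
  have "(transition c d \<circ> (cmap c \<circ> \<gamma>) has_derivative ?T \<circ> (\<lambda>s. s *\<^sub>R u)) (at t within I)"
    using deriv T unfolding has_vector_derivative_def
    by (intro diff_chain_within) (auto intro: has_derivative_at_withinI)
  moreover have "?T \<circ> (\<lambda>s. s *\<^sub>R u) = (\<lambda>s. s *\<^sub>R ?T u)"
    using linear_scale[OF has_derivative_linear[OF T]] by auto
  ultimately have *: "(transition c d \<circ> (cmap c \<circ> \<gamma>) has_vector_derivative ?T u) (at t within I)"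
    unfolding has_vector_derivative_def by simp
  obtain \<epsilon> where \<epsilon>: "\<epsilon> > 0" "\<And>s. s \<in> I \<Longrightarrow> \<bar>s - t\<bar> < \<epsilon> \<Longrightarrow> \<gamma> s \<in> cdom c"
    using eventually_in_open[OF \<gamma> open_cdom[OF cd(1)] cd(3)] by blast
  show ?thesis
    using * \<epsilon>(1) \<gamma>(2)
    by (rule has_vector_derivative_transform_within)
      (use \<epsilon>(2) in \<open>auto simp: transition_cmap cd dist_real_def\<close>)
qed

text \<open>
  The components of the gradient transform under a change of charts in the same way as the derivatives of
  a curve.
\<close>

lemma descent_curveI:
  assumes \<gamma>: "continuous_on I \<gamma>"
    and deriv: "\<And>t. t \<in> I \<Longrightarrow> \<exists>c\<in>A. \<gamma> t \<in> cdom c \<and>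
      ((cmap c \<circ> \<gamma>) has_vector_derivative - gradient A g E (\<gamma> t) c) (at t within I)"
  shows "descent_curve I \<gamma>"
  unfolding descent_curve_def
proof (intro conjI ballI impI)
  fix t d
  assume t: "t \<in> I" and d: "d \<in> A" "\<gamma> t \<in> cdom d"
  obtain c where c: "c \<in> A" "\<gamma> t \<in> cdom c"
      "((cmap c \<circ> \<gamma>) has_vector_derivative - gradient A g E (\<gamma> t) c) (at t within I)"
    using deriv[OF t] by blast
  let ?T = "frechet_derivative (transition c d) (at (cmap c (\<gamma> t)))"
  have "?T (- gradient A g E (\<gamma> t) c) = - ?T (gradient A g E (\<gamma> t) c)"
    using linear_neg[OF has_derivative_linear[OF transition_has_derivative]] c d by blast
  also have "\<dots> = - gradient A g E (\<gamma> t) d"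
    using tangent_transition[OF gradient_in_tangent_space] c d by metis
  finally show "((cmap d \<circ> \<gamma>) has_vector_derivative - gradient A g E (\<gamma> t) d) (at t within I)"
    using curve_derivative_change_chart[OF \<gamma> t c(1) d(1) c(2) d(2) c(3)] by simp
qed (rule \<gamma>)

lemma descent_curve_local:
  assumes "\<And>t. t \<in> I \<Longrightarrow> \<exists>J \<delta> \<epsilon>. descent_curve J \<delta> \<and> 0 < \<epsilon> \<and>
    (\<forall>s\<in>I. \<bar>s - t\<bar> < \<epsilon> \<longrightarrow> s \<in> J \<and> \<gamma> s = \<delta> s)"
  shows "descent_curve I \<gamma>"
proof -
  have loc: "(\<gamma> \<longlongrightarrow> \<gamma> t) (at t within I) \<and> (\<forall>c\<in>A. \<gamma> t \<in> cdom c \<longrightarrow>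
        ((cmap c \<circ> \<gamma>) has_vector_derivative - gradient A g E (\<gamma> t) c) (at t within I))"
    if t: "t \<in> I" for t
  proof -
    obtain J \<delta> \<epsilon> where \<delta>: "descent_curve J \<delta>" and "0 < \<epsilon>"
        and eq: "\<And>s. s \<in> I \<Longrightarrow> \<bar>s - t\<bar> < \<epsilon> \<Longrightarrow> s \<in> J \<and> \<gamma> s = \<delta> s"
      using assms[OF t] by metis
    define I' where "I' = I \<inter> ball t \<epsilon>"
    have I': "t \<in> I'" "I' \<subseteq> J" "\<And>s. s \<in> I' \<Longrightarrow> \<gamma> s = \<delta> s"
      using t eq \<open>0 < \<epsilon>\<close> unfolding I'_def by (auto simp: dist_real_def abs_minus_commute)
    have at: "at t within I = at t within I'"
      unfolding I'_def by (rule at_within_nhd[of t "ball t \<epsilon>"]) (use \<open>0 < \<epsilon>\<close> in auto)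
    have \<delta>': "descent_curve I' \<delta>"
      using descent_curve_subset[OF \<delta> I'(2)] .
    have "continuous_on I' \<gamma>"
      using descent_curve_continuous[OF \<delta>'] I'(3) by (simp cong: continuous_on_cong)
    then have "(\<gamma> \<longlongrightarrow> \<gamma> t) (at t within I)"
      unfolding at using I'(1) by (simp add: continuous_on_def)
    moreover have "((cmap c \<circ> \<gamma>) has_vector_derivative - gradient A g E (\<gamma> t) c) (at t within I)"
      if "c \<in> A" "\<gamma> t \<in> cdom c" for c
      unfolding at
    proof (rule has_vector_derivative_transform[OF I'(1)])
      show "((cmap c \<circ> \<delta>) has_vector_derivative - gradient A g E (\<gamma> t) c) (at t within I')"
        using descent_curve_derivative[OF \<delta>' I'(1), of c] that I'(1,3) by simp
    qed (simp add: I'(3))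
    ultimately show ?thesis
      by blast
  qed
  then show ?thesis
    unfolding descent_curve_def continuous_on_def by blast
qed

lemma energy_derivative:
  assumes \<gamma>: "descent_curve I \<gamma>" and t: "t \<in> I"
  shows "((\<lambda>t. E (\<gamma> t)) has_real_derivative - gradient_norm_sq (\<gamma> t)) (at t within I)"
proof -
  obtain c where c: "c \<in> A" "\<gamma> t \<in> cdom c"
    by (rule obtain_chart)
  let ?n = "gradient A g E (\<gamma> t)"
  obtain D where D: "((E \<circ> cinv c) has_derivative blinfun_apply D) (at (cmap c (\<gamma> t)))"
      "\<And>h. h \<in> tangent_space A (\<gamma> t) \<Longrightarrow> differential A E (\<gamma> t) h = blinfun_apply D (h c)"
    using obtain_chart_differential[OF c(1)] c(2) by metis
  have "D (- ?n c) = - gradient_norm_sq (\<gamma> t)"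
    using D(2)[OF gradient_in_tangent_space] differential_eq_gradient[OF gradient_in_tangent_space]
    by (simp add: gradient_norm_sq_def blinfun.minus_right)
  moreover have "(E \<circ> cinv c \<circ> (cmap c \<circ> \<gamma>) has_derivative D \<circ> (\<lambda>s. s *\<^sub>R (- ?n c))) (at t within I)"
    using descent_curve_derivative[OF \<gamma> t c] D(1) unfolding has_vector_derivative_def
    by (intro diff_chain_within) (auto intro: has_derivative_at_withinI)
  ultimately have "((E \<circ> cinv c \<circ> (cmap c \<circ> \<gamma>)) has_vector_derivative - gradient_norm_sq (\<gamma> t)) (at t within I)"
    unfolding has_vector_derivative_def
    by (elim has_derivative_eq_rhs) (auto simp: blinfun.scaleR_right simp del: scaleR_minus_right)
  moreover obtain \<epsilon> where "\<epsilon> > 0" "\<And>s. s \<in> I \<Longrightarrow> \<bar>s - t\<bar> < \<epsilon> \<Longrightarrow> \<gamma> s \<in> cdom c"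
    using eventually_in_open[OF descent_curve_continuous[OF \<gamma>] t open_cdom[OF c(1)] c(2)] by blast
  ultimately have "((\<lambda>t. E (\<gamma> t)) has_vector_derivative - gradient_norm_sq (\<gamma> t)) (at t within I)"
    using t by (elim has_vector_derivative_transform_within)
      (auto simp: cinv_cmap c dist_real_def)
  then show ?thesis
    by (simp add: has_real_derivative_iff_has_vector_derivative)
qed

lemma energy_antimono:
  assumes \<gamma>: "descent_curve I \<gamma>" and I: "{s..t} \<subseteq> I" and "s \<le> t"
  shows "E (\<gamma> t) \<le> E (\<gamma> s)"
proof (rule DERIV_nonpos_imp_decreasing_open[OF \<open>s \<le> t\<close>, of "\<lambda>t. E (\<gamma> t)"])
  fix x
  assume x: "s < x" "x < t"
  have "((\<lambda>t. E (\<gamma> t)) has_real_derivative - gradient_norm_sq (\<gamma> x)) (at x)"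
  proof -
    have "x \<in> I"
      using I x by auto
    then show ?thesis
      using energy_derivative[OF \<gamma>, of x] at_within_interval_interior[OF I x] by simp
  qed
  then show "\<exists>y. ((\<lambda>t. E (\<gamma> t)) has_real_derivative y) (at x) \<and> y \<le> 0"
    using gradient_norm_sq_nonneg by (metis neg_le_0_iff_le)
next
  show "continuous_on {s..t} (\<lambda>t. E (\<gamma> t))"
    by (rule DERIV_continuous_on[OF energy_derivative[OF descent_curve_subset[OF \<gamma> I]]])
qed

text \<open>
  In a chart, the difference \<open>w\<close> of two integral curves satisfies \<open>\<parallel>w'\<parallel> \<le> L \<parallel>w\<parallel>\<close> by the local
  Lipschitz continuity of the gradient, so \<open>linear_growth_zero_iff\<close> applies, both forwards and
  backwards in time.
\<close>

lemma descent_curve_locally_unique: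
  assumes \<gamma>: "descent_curve I \<gamma>" and \<delta>: "descent_curve I \<delta>" and I: "is_interval I"
    and t1: "t1 \<in> I" "\<gamma> t1 = \<delta> t1"
  shows "\<exists>\<epsilon>>0. \<forall>t\<in>I. \<bar>t - t1\<bar> < \<epsilon> \<longrightarrow> \<gamma> t = \<delta> t"
proof -
  obtain c where c: "c \<in> A" "\<gamma> t1 \<in> cdom c"
    by (rule obtain_chart)
  define F where "F y = gradient A g E (cinv c y) c" for y
  obtain r L where r: "r > 0" and L: "L-lipschitz_on (cball (cmap c (\<gamma> t1)) r) F"
    using gradient_locally_lipschitz[OF c] unfolding F_def by blast
  define W where "W = cdom c \<inter> cmap c -` ball (cmap c (\<gamma> t1)) r"
  have "open W" "\<gamma> t1 \<in> W"
    unfolding W_def using continuous_open_preimage[OF continuous_cmap open_cdom open_ball] c r by auto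
  obtain \<epsilon>1 where \<epsilon>1: "\<epsilon>1 > 0" "\<And>s. s \<in> I \<Longrightarrow> \<bar>s - t1\<bar> < \<epsilon>1 \<Longrightarrow> \<gamma> s \<in> W"
    using eventually_in_open[OF descent_curve_continuous[OF \<gamma>] t1(1) \<open>open W\<close> \<open>\<gamma> t1 \<in> W\<close>] by blast
  obtain \<epsilon>2 where \<epsilon>2: "\<epsilon>2 > 0" "\<And>s. s \<in> I \<Longrightarrow> \<bar>s - t1\<bar> < \<epsilon>2 \<Longrightarrow> \<delta> s \<in> W"
    using eventually_in_open[OF descent_curve_continuous[OF \<delta>] t1(1) \<open>open W\<close>] \<open>\<gamma> t1 \<in> W\<close> t1(2) by auto
  define \<epsilon> where "\<epsilon> = min \<epsilon>1 \<epsilon>2"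
  define w where "w s = cmap c (\<gamma> s) - cmap c (\<delta> s)" for s
  have W: "\<gamma> s \<in> W" "\<delta> s \<in> W" if "s \<in> I" "\<bar>s - t1\<bar> < \<epsilon>" for s
    using \<epsilon>1(2) \<epsilon>2(2) that unfolding \<epsilon>_def by auto
  have dw: "(w has_vector_derivative F (cmap c (\<delta> s)) - F (cmap c (\<gamma> s))) (at s within I)"
    if s: "s \<in> I" "\<bar>s - t1\<bar> < \<epsilon>" for s
  proof -
    have "\<gamma> s \<in> cdom c" "\<delta> s \<in> cdom c"
      using W[OF s] unfolding W_def by auto
    then show ?thesis
      using has_vector_derivative_diff[OF descent_curve_derivative[OF \<gamma> s(1) c(1)] descent_curve_derivative[OF \<delta> s(1) c(1)]]
      by (simp add: w_def[abs_def] F_def cinv_cmap c comp_def)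
  qed
  have zero: "w a = 0 \<longleftrightarrow> w b = 0" if ab: "a \<le> b" "{a..b} \<subseteq> I" "\<And>s. s \<in> {a..b} \<Longrightarrow> \<bar>s - t1\<bar> < \<epsilon>" for a b
  proof (rule linear_growth_zero_iff[OF ab(1)])
    show "continuous_on {a..b} w"
      by (rule continuous_on_vector_derivative[OF has_vector_derivative_within_subset[OF dw ab(2)]])
        (use ab(2,3) in auto)
    fix s
    assume s: "a < s" "s < b"
    then have s': "s \<in> I" "\<bar>s - t1\<bar> < \<epsilon>"
      using ab by auto
    show "(w has_vector_derivative F (cmap c (\<delta> s)) - F (cmap c (\<gamma> s))) (at s)"
      using dw[OF s'] at_within_interval_interior[OF ab(2) s] by simp
    show "norm (F (cmap c (\<delta> s)) - F (cmap c (\<gamma> s))) \<le> L * norm (w s)"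
      using lipschitz_onD[OF L, of "cmap c (\<delta> s)" "cmap c (\<gamma> s)"] W[OF s']
      unfolding W_def w_def by (simp add: dist_norm norm_minus_commute)
  qed
  have "\<gamma> t = \<delta> t" if t: "t \<in> I" "\<bar>t - t1\<bar> < \<epsilon>" for t
  proof -
    have "w t1 = 0"
      unfolding w_def using t1(2) by simp
    have sub: "{min t t1..max t t1} \<subseteq> I"
    proof
      fix s
      assume "s \<in> {min t t1..max t t1}"
      then have "t \<le> s \<and> s \<le> t1 \<or> t1 \<le> s \<and> s \<le> t"
        by auto
      then show "s \<in> I"
        using I t(1) t1(1) unfolding is_interval_1 by blast
    qed
    have "w (min t t1) = 0 \<longleftrightarrow> w (max t t1) = 0"
      using sub t(2) by (intro zero) auto
    then have "w t = 0"
      using \<open>w t1 = 0\<close> by (auto simp: min_def max_def split: if_splits)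
    then have "cinv c (cmap c (\<gamma> t)) = cinv c (cmap c (\<delta> t))"
      unfolding w_def by simp
    moreover have "\<gamma> t \<in> cdom c" "\<delta> t \<in> cdom c"
      using W[OF t] unfolding W_def by blast+
    ultimately show ?thesis
      using cinv_cmap[OF c(1)] by metis
  qed
  then show ?thesis
    using \<epsilon>1(1) \<epsilon>2(1) unfolding \<epsilon>_def by (intro exI[of _ "min \<epsilon>1 \<epsilon>2"]) auto
qed

text \<open>
  The set of times at which the two curves agree is open in \<open>I\<close> by local uniqueness and closed because
  the manifold is Hausdorff.
\<close>

lemma descent_curve_unique:
  assumes \<gamma>: "descent_curve I \<gamma>" and \<delta>: "descent_curve I \<delta>" and I: "is_interval I"
    and u: "u \<in> I" "\<gamma> u = \<delta> u" and t: "t \<in> I"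
  shows "\<gamma> t = \<delta> t"
proof -
  define S where "S = {s\<in>I. \<gamma> s = \<delta> s}"
  have "openin (top_of_set I) S"
    unfolding openin_euclidean_subtopology_iff
  proof (intro conjI ballI)
    show "S \<subseteq> I"
      unfolding S_def by blast
    show "\<exists>e>0. \<forall>x'\<in>I. dist x' x < e \<longrightarrow> x' \<in> S" if "x \<in> S" for x
      using descent_curve_locally_unique[OF \<gamma> \<delta> I, of x] that unfolding S_def dist_real_def by auto
  qed
  moreover have "closedin (top_of_set I) S"
  proof -
    have "continuous_on I (\<lambda>s. (\<gamma> s, \<delta> s))"
      by (intro continuous_intros descent_curve_continuous[OF \<gamma>] descent_curve_continuous[OF \<delta>])
    from continuous_closedin_preimage[OF this closed_diagonal]
    show ?thesis
      unfolding S_def by (rule back_subst[of "closedin _"]) auto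
  qed
  ultimately have "S = {} \<or> S = I"
    using I connected_clopen is_interval_connected by blast
  then show ?thesis
    using u t unfolding S_def by blast
qed

lemma descent_curve_const:
  assumes "critical_point A E x"
  shows "descent_curve I (\<lambda>_. x)"
  using assms critical_point_iff_gradient unfolding descent_curve_def
  by (auto simp: comp_def)

text \<open>
  If the curve reached a critical point at some time, it would coincide with the constant curve through
  that point, by uniqueness backwards in time, and would start at a critical point.
\<close>

lemma energy_strictly_decreasing:
  assumes \<gamma>: "descent_curve {0..} \<gamma>" and "\<not> critical_point A E (\<gamma> 0)"
  shows "strict_antimono_on {0..} (\<lambda>t. E (\<gamma> t))"
proof (rule monotone_onI)
  have noncritical: "\<not> critical_point A E (\<gamma> t)" if "t \<in> {0..}" for t
  proof
    assume "critical_point A E (\<gamma> t)"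
    then have "descent_curve {0..} (\<lambda>_. \<gamma> t)"
      by (rule descent_curve_const)
    from descent_curve_unique[OF \<gamma> this is_interval_ci that, of 0] have "\<gamma> 0 = \<gamma> t"
      by simp
    then show False
      using assms(2) \<open>critical_point A E (\<gamma> t)\<close> by simp
  qed
  fix s t :: real
  assume st: "s \<in> {0..}" "t \<in> {0..}" "s < t"
  have I: "{s..t} \<subseteq> {0..}"
    using st by auto
  show "E (\<gamma> s) > E (\<gamma> t)"
  proof (rule DERIV_neg_imp_decreasing_open[OF st(3), of "\<lambda>t. E (\<gamma> t)"])
    fix u
    assume u: "s < u" "u < t"
    then have "u \<in> {0..}"
      using st by auto
    have "((\<lambda>t. E (\<gamma> t)) has_real_derivative - gradient_norm_sq (\<gamma> u)) (at u)"
      using energy_derivative[OF \<gamma> \<open>u \<in> {0..}\<close>] at_within_interval_interior[OF I u] by simp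
    moreover have "0 < gradient_norm_sq (\<gamma> u)"
      using noncritical[OF \<open>u \<in> {0..}\<close>] gradient_norm_sq_eq_0_iff gradient_norm_sq_nonneg by (metis less_le)
    ultimately show "\<exists>y. ((\<lambda>t. E (\<gamma> t)) has_real_derivative y) (at u) \<and> y < 0"
      by force
  next
    show "continuous_on {s..t} (\<lambda>t. E (\<gamma> t))"
      by (rule DERIV_continuous_on[OF energy_derivative[OF descent_curve_subset[OF \<gamma> I]]])
  qed
qed

lemma descent_curve_exists_locally: "\<exists>\<delta>>0. \<exists>\<gamma>. descent_curve {0..\<delta>} \<gamma> \<and> \<gamma> 0 = x"
proof -
  obtain c where c: "c \<in> A" "x \<in> cdom c"
    by (rule obtain_chart)
  define F where "F y = - gradient A g E (cinv c y) c" for y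
  obtain r L where r: "r > 0" "cball (cmap c x) r \<subseteq> cmap c ` cdom c" and L: "L-lipschitz_on (cball (cmap c x) r) F"
    using gradient_locally_lipschitz[OF c] lipschitz_on_minus unfolding F_def by blast
  obtain d z where "d > 0" and z: "z 0 = cmap c x" "\<And>t. t \<in> {0..d} \<Longrightarrow> z t \<in> cball (cmap c x) r"
      "\<And>t. t \<in> {0..d} \<Longrightarrow> (z has_vector_derivative F (z t)) (at t within {0..d})"
    using picard_lindelof_hilbert[OF r(1) L] by metis
  have zc: "z t \<in> cmap c ` cdom c" if "t \<in> {0..d}" for t
    using z(2)[OF that] r(2) by blast
  define \<gamma> where "\<gamma> t = cinv c (z t)" for t
  have "descent_curve {0..d} \<gamma>"
  proof (rule descent_curveI)
    have "continuous_on {0..d} z"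
      using z(3) by (rule continuous_on_vector_derivative)
    then show "continuous_on {0..d} \<gamma>"
      unfolding \<gamma>_def using zc by (intro continuous_on_compose2[OF continuous_cinv[OF c(1)]]) auto
    fix t
    assume t: "t \<in> {0..d}"
    have "((cmap c \<circ> \<gamma>) has_vector_derivative F (z t)) (at t within {0..d})"
      using t by (rule has_vector_derivative_transform[OF _ _ z(3)[OF t]]) (simp add: \<gamma>_def cmap_cinv[OF c(1) zc])
    then show "\<exists>c\<in>A. \<gamma> t \<in> cdom c \<and>
        ((cmap c \<circ> \<gamma>) has_vector_derivative - gradient A g E (\<gamma> t) c) (at t within {0..d})"
      using c cinv_in_cdom[OF c(1) zc[OF t]] unfolding \<gamma>_def F_def by blast
  qed
  then show ?thesis
    using \<open>d > 0\<close> z(1) c by (intro exI[of _ d] conjI exI[of _ \<gamma>]) (auto simp: \<gamma>_def cinv_cmap)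
qed

text \<open>
  Affine changes of the time parameter, with \<open>r\<close> of either sign, turn pieces of an integral curve into
  curves on \<open>[0, 1]\<close>, as required by the path metric, and shift the time when two integral curves are
  joined.
\<close>

lemma reparametrized_derivative:
  assumes \<gamma>: "descent_curve I \<gamma>" and J: "\<And>s. s \<in> J \<Longrightarrow> a + r * s \<in> I" and s: "s \<in> J"
    and c: "c \<in> A" "\<gamma> (a + r * s) \<in> cdom c"
  shows "((cmap c \<circ> (\<lambda>s. \<gamma> (a + r * s))) has_vector_derivative r *\<^sub>R - gradient A g E (\<gamma> (a + r * s)) c)
    (at s within J)"
proof -
  have "((\<lambda>s. a + r * s) has_vector_derivative r) (at s within J)"
    by (auto intro!: derivative_eq_intros simp: has_real_derivative_iff_has_vector_derivative[symmetric])
  moreover have "((cmap c \<circ> \<gamma>) has_vector_derivative - gradient A g E (\<gamma> (a + r * s)) c)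
      (at (a + r * s) within (\<lambda>s. a + r * s) ` J)"
    by (rule has_vector_derivative_within_subset[OF descent_curve_derivative[OF \<gamma> J[OF s] c]]) (use J in blast)
  ultimately show ?thesis
    using vector_diff_chain_within by (fastforce simp: comp_def)
qed

lemma reparametrized_C1_curve:
  assumes \<gamma>: "descent_curve I \<gamma>" and J: "\<And>s. s \<in> J \<Longrightarrow> a + r * s \<in> I"
    and lim: "\<And>s. s \<in> J \<Longrightarrow> at s within J \<noteq> bot"
  shows "C1_curve A J (\<lambda>s. \<gamma> (a + r * s))"
    and "s \<in> J \<Longrightarrow> velocity A J (\<lambda>s. \<gamma> (a + r * s)) s = (\<lambda>c. - r *\<^sub>R gradient A g E (\<gamma> (a + r * s)) c)"
proof -
  let ?\<eta> = "\<lambda>s. \<gamma> (a + r * s)"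
  have cont: "continuous_on J ?\<eta>"
    using J by (intro continuous_on_compose2[OF descent_curve_continuous[OF \<gamma>]] continuous_intros) auto
  have deriv: "((cmap c \<circ> ?\<eta>) has_vector_derivative - r *\<^sub>R gradient A g E (?\<eta> s) c) (at s within J)"
    if "s \<in> J" "c \<in> A" "?\<eta> s \<in> cdom c" for s c
    using reparametrized_derivative[OF \<gamma> J that] by simp
  have vd: "vector_derivative (cmap c \<circ> ?\<eta>) (at s within J) = - r *\<^sub>R gradient A g E (?\<eta> s) c"
    if "s \<in> J" "c \<in> A" "?\<eta> s \<in> cdom c" for s c
    using vector_derivative_within[OF lim deriv] that by blast
  show "C1_curve A J ?\<eta>"
    unfolding C1_curve_def
  proof (intro conjI ballI)
    fix c
    assume c: "c \<in> A"
    let ?S = "{s \<in> J. ?\<eta> s \<in> cdom c}"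
    show "(cmap c \<circ> ?\<eta>) differentiable (at s within J)" if "s \<in> ?S" for s
      using deriv c that differentiableI_vector by blast
    have "continuous_on ?S (\<lambda>s. gradient A g E (?\<eta> s) c)"
      by (rule continuous_on_compose2[OF continuous_gradient_component[OF c] continuous_on_subset[OF cont]]) auto
    then have "continuous_on ?S (\<lambda>s. - r *\<^sub>R gradient A g E (?\<eta> s) c)"
      by (intro continuous_intros)
    then show "continuous_on ?S (\<lambda>s. vector_derivative (cmap c \<circ> ?\<eta>) (at s within J))"
      by (rule continuous_on_eq) (use vd c in auto)
  qed (rule cont)
  show "velocity A J ?\<eta> s = (\<lambda>c. - r *\<^sub>R gradient A g E (?\<eta> s) c)" if s: "s \<in> J"
  proof
    fix c
    have "\<not> (c \<in> A \<and> ?\<eta> s \<in> cdom c) \<Longrightarrow> gradient A g E (?\<eta> s) c = 0"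
      using gradient_in_tangent_space unfolding tangent_space_def by blast
    then show "velocity A J ?\<eta> s c = - r *\<^sub>R gradient A g E (?\<eta> s) c"
      unfolding velocity_def using vd[OF s] by simp
  qed
qed

text \<open>
  The second curve is written as \<open>t \<mapsto> \<eta> (- a + 1 * t)\<close> to match \<open>reparametrized_derivative\<close>.  At the
  junction \<open>a\<close> the two one-sided derivatives agree, because both are the negative gradient at the same
  point.
\<close>

lemma descent_curve_append:
  assumes \<gamma>: "descent_curve {0..a} \<gamma>" and \<eta>: "descent_curve {0..b} \<eta>" and "0 \<le> a" "0 \<le> b" "\<eta> 0 = \<gamma> a"
  shows "descent_curve {0..a + b} (\<lambda>t. if t \<in> {0..a} then \<gamma> t else \<eta> (- a + 1 * t))"
    (is "descent_curve _ ?\<zeta>")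
proof -
  have un: "{0..a + b} = {0..a} \<union> {a..a + b}"
    using assms(3,4) by auto
  have int: "{0..a} \<inter> {a..a + b} = {a}"
    using assms(3,4) by auto
  have J: "- a + 1 * s \<in> {0..b}" if "s \<in> {a..a + b}" for s
    using that by auto
  have cont2: "continuous_on {a..a + b} (\<lambda>t. \<eta> (- a + 1 * t))"
    by (intro continuous_on_compose2[OF descent_curve_continuous[OF \<eta>]] continuous_intros) auto
  show ?thesis
    unfolding descent_curve_def
  proof (intro conjI ballI impI)
    show "continuous_on {0..a + b} ?\<zeta>"
      unfolding un
      by (rule continuous_on_cases[OF _ _ descent_curve_continuous[OF \<gamma>] cont2])
        (use assms in auto)
    fix t c
    assume t: "t \<in> {0..a + b}" and c: "c \<in> A" "?\<zeta> t \<in> cdom c"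
    let ?f' = "\<lambda>t. - gradient A g E (\<gamma> t) c" and ?g' = "\<lambda>t. 1 *\<^sub>R - gradient A g E (\<eta> (- a + 1 * t)) c"
    have "((\<lambda>t. if t \<in> {0..a} then (cmap c \<circ> \<gamma>) t else (cmap c \<circ> (\<lambda>t. \<eta> (- a + 1 * t))) t)
        has_vector_derivative (if t \<in> {0..a} then ?f' t else ?g' t)) (at t within {0..a + b})"
    proof (rule has_vector_derivative_If_within_closures)
      show "t \<in> {0..a} \<union> {a..a + b}" "{0..a + b} = {0..a} \<union> {a..a + b}"
        using t un by auto
      have cl: "{0..a} \<union> closure {0..a} \<inter> closure {a..a + b} = {0..a}"
          "{a..a + b} \<union> closure {0..a} \<inter> closure {a..a + b} = {a..a + b}"
        using int assms(3,4) by auto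
      show "((cmap c \<circ> \<gamma>) has_vector_derivative ?f' t)
          (at t within {0..a} \<union> closure {0..a} \<inter> closure {a..a + b})"
        if "t \<in> {0..a} \<union> closure {0..a} \<inter> closure {a..a + b}"
        using that c descent_curve_derivative[OF \<gamma>, of t c] unfolding cl by auto
      show "((cmap c \<circ> (\<lambda>t. \<eta> (- a + 1 * t))) has_vector_derivative ?g' t)
          (at t within {a..a + b} \<union> closure {0..a} \<inter> closure {a..a + b})"
        if "t \<in> {a..a + b} \<union> closure {0..a} \<inter> closure {a..a + b}"
        unfolding cl
      proof (rule reparametrized_derivative[OF \<eta> J])
        show "t \<in> {a..a + b}" "c \<in> A"
          using that c unfolding cl by auto
        then show "\<eta> (- a + 1 * t) \<in> cdom c"
          using c(2) assms(5) by (cases "t = a") (auto split: if_splits)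
      qed
      have eq: "\<gamma> t = \<eta> (- a + 1 * t)" if "t \<in> closure {0..a}" "t \<in> closure {a..a + b}"
      proof -
        have "t = a"
          using that by simp
        then show ?thesis
          using assms(5) by simp
      qed
      show "(cmap c \<circ> \<gamma>) t = (cmap c \<circ> (\<lambda>t. \<eta> (- a + 1 * t))) t" "?f' t = ?g' t"
        if "t \<in> closure {0..a}" "t \<in> closure {a..a + b}"
        using eq[OF that] by simp_all
    qed
    moreover have "(\<lambda>t. if t \<in> {0..a} then (cmap c \<circ> \<gamma>) t else (cmap c \<circ> (\<lambda>t. \<eta> (- a + 1 * t))) t)
        = cmap c \<circ> ?\<zeta>" "(if t \<in> {0..a} then ?f' t else ?g' t) = - gradient A g E (?\<zeta> t) c"
      by auto
    ultimately show "((cmap c \<circ> ?\<zeta>) has_vector_derivative - gradient A g E (?\<zeta> t) c) (at t within {0..a + b})"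
      by (simp only:)
  qed
qed

section \<open>Length of integral curves and existence for all times\<close>

text \<open>
  By uniqueness, any two of the given curves agree where both are defined, so they fit together to one
  curve.
\<close>

lemma descent_curve_union:
  fixes J :: "real set"
  assumes ex: "\<And>T. T \<in> J \<Longrightarrow> \<exists>\<gamma>. descent_curve {0..T} \<gamma> \<and> \<gamma> 0 = x" and J: "\<exists>T\<in>J. 0 < T"
  shows "\<exists>\<gamma>. descent_curve (\<Union>T\<in>J. {0..<T}) \<gamma> \<and> \<gamma> 0 = x"
proof -
  obtain G where G: "\<And>T. T \<in> J \<Longrightarrow> descent_curve {0..T} (G T)" "\<And>T. T \<in> J \<Longrightarrow> G T 0 = x"
    using ex by metis
  define \<gamma> where "\<gamma> t = G (SOME T. T \<in> J \<and> t < T) t" for t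
  have \<gamma>: "\<gamma> t = G T t" if "T \<in> J" "0 \<le> t" "t < T" for t T
  proof -
    define S where "S = (SOME T. T \<in> J \<and> t < T)"
    have S: "S \<in> J" "t < S"
      unfolding S_def using someI[of "\<lambda>T. T \<in> J \<and> t < T" T] that by auto
    have "G S t = G T t"
    proof (rule descent_curve_unique[where I = "{0..t}" and t = t and u = 0])
      show "descent_curve {0..t} (G S)" "descent_curve {0..t} (G T)"
        using descent_curve_subset[OF G(1)] S that by auto
    qed (use G S that in \<open>auto simp: is_interval_cc\<close>)
    then show ?thesis
      unfolding \<gamma>_def S_def .
  qed
  have "descent_curve (\<Union>T\<in>J. {0..<T}) \<gamma>"
  proof (rule descent_curve_local)
    fix t
    assume "t \<in> (\<Union>T\<in>J. {0..<T})"
    then obtain T where T: "T \<in> J" "0 \<le> t" "t < T"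
      by auto
    show "\<exists>J' \<delta> \<epsilon>. descent_curve J' \<delta> \<and> 0 < \<epsilon> \<and>
        (\<forall>s\<in>\<Union>T\<in>J. {0..<T}. \<bar>s - t\<bar> < \<epsilon> \<longrightarrow> s \<in> J' \<and> \<gamma> s = \<delta> s)"
      using T G(1)[OF T(1)] \<gamma>[OF T(1)]
      by (intro exI[of _ "{0..T}"] exI[of _ "G T"] exI[of _ "T - t"]) auto
  qed
  moreover have "\<gamma> 0 = x"
    using J \<gamma>[of _ 0] G(2) by auto
  ultimately show ?thesis
    by blast
qed

lemma tnorm_scaled_gradient: "tnorm g x (\<lambda>c. r *\<^sub>R gradient A g E x c) = \<bar>r\<bar> * sqrt (gradient_norm_sq x)"
proof -
  have "inner_product_on (tangent_space A x) (g x)"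
    using manifold unfolding riemannian_manifold_def strong_C1_metric_def by blast
  then have sym: "\<And>u v. u \<in> tangent_space A x \<Longrightarrow> v \<in> tangent_space A x \<Longrightarrow> g x u v = g x v u"
    and scale: "\<And>r u v. u \<in> tangent_space A x \<Longrightarrow> v \<in> tangent_space A x \<Longrightarrow> g x (\<lambda>i. r *\<^sub>R u i) v = r * g x u v"
    unfolding inner_product_on_def by blast+
  obtain c where c: "c \<in> A" "x \<in> cdom c"
    by (rule obtain_chart)
  let ?n = "gradient A g E x" and ?rn = "\<lambda>c. r *\<^sub>R gradient A g E x c"
  have n: "?n \<in> tangent_space A x"
    by (rule gradient_in_tangent_space)
  have "?rn = tangent_of c x (r *\<^sub>R ?n c)"
  proof
    fix d
    show "?rn d = tangent_of c x (r *\<^sub>R ?n c) d"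
      using linear_scale[OF has_derivative_linear[OF transition_has_derivative, of c d x], of r "?n c"]
        fun_cong[OF tangent_of_component[OF c n], of d] c unfolding tangent_of_def by auto
  qed
  then have rn: "?rn \<in> tangent_space A x"
    using tangent_of_in_tangent_space[OF c] by simp
  have "g x ?rn ?rn = r\<^sup>2 * gradient_norm_sq x"
    using scale[OF n rn, of r] sym[OF n rn] scale[OF n n, of r] by (simp add: gradient_norm_sq_def power2_eq_square)
  then show ?thesis
    unfolding tnorm_def by (simp add: real_sqrt_mult)
qed

lemma velocity_in_tangent_space:
  assumes \<eta>: "C1_curve A I \<eta>" and t: "t \<in> I" and lim: "at t within I \<noteq> bot"
  shows "velocity A I \<eta> t \<in> tangent_space A (\<eta> t)"
  unfolding tangent_space_def
proof (intro CollectI conjI allI ballI impI)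
  fix c d
  assume c: "c \<in> A" and d: "d \<in> A" and cd: "\<eta> t \<in> cdom c \<and> \<eta> t \<in> cdom d"
  have "((cmap c \<circ> \<eta>) has_vector_derivative vector_derivative (cmap c \<circ> \<eta>) (at t within I)) (at t within I)"
    using \<eta> t c cd unfolding C1_curve_def by (auto simp: vector_derivative_works)
  then have "vector_derivative (cmap d \<circ> \<eta>) (at t within I)
      = frechet_derivative (transition c d) (at (cmap c (\<eta> t))) (vector_derivative (cmap c \<circ> \<eta>) (at t within I))"
    using \<eta> t c d cd unfolding C1_curve_def
    by (intro vector_derivative_within[OF lim] curve_derivative_change_chart) auto
  then show "velocity A I \<eta> t d = frechet_derivative (transition c d) (at (cmap c (\<eta> t))) (velocity A I \<eta> t c)"
    unfolding velocity_def using c d cd by simp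
qed (auto simp: velocity_def)

text \<open>
  This bounds below the set of lengths whose infimum is the path metric.  It needs the velocity to lie in
  the tangent space, because \<open>sqrt\<close> takes negative values at negative arguments.
\<close>

lemma curve_length_nonneg:
  assumes \<eta>: "C1_curve A {0..1} \<eta>"
  shows "0 \<le> curve_length A g \<eta>"
proof -
  have "0 \<le> tnorm g x v" if v: "v \<in> tangent_space A x" for x v
  proof -
    obtain c where c: "c \<in> A" "x \<in> cdom c"
      by (rule obtain_chart)
    obtain G where "g x v v = blinfun_apply (blinfun_apply (G (cmap c x)) (v c)) (v c)"
      "\<exists>\<kappa>>0. \<forall>v. \<kappa> * (norm v)\<^sup>2 \<le> G (cmap c x) v v"
      using obtain_chart_metric[OF c(1)] c(2) v by metis
    then have "0 \<le> g x v v"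
      by (metis less_imp_le mult_nonneg_nonneg order_trans zero_le_power2)
    then show ?thesis
      unfolding tnorm_def by simp
  qed
  then have "0 \<le> tnorm g (\<eta> t) (velocity A {0..1} \<eta> t)" if "t \<in> {0..1}" for t
    using velocity_in_tangent_space[OF \<eta> that unit_interval_limit_point[OF that]] by blast
  then show ?thesis
    unfolding curve_length_def
    by (cases "(\<lambda>t. tnorm g (\<eta> t) (velocity A {0..1} \<eta> t)) integrable_on {0..1}")
      (auto intro: integral_nonneg simp: not_integrable_integral)
qed

text \<open>
  The length of the piece of curve between \<open>s\<close> and \<open>t\<close> is the integral of the norm of the gradient, and
  \<open>\<parallel>\<nabla>E\<parallel> \<le> (1 + \<parallel>\<nabla>E\<parallel>\<^sup>2) / 2\<close>, where \<open>1 + \<parallel>\<nabla>E\<parallel>\<^sup>2\<close> is the derivative of \<open>t - E(\<gamma> t)\<close>.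
\<close>

lemma path_dist_descent_curve_le:
  assumes \<gamma>: "descent_curve I \<gamma>" and I: "is_interval I" "s \<in> I" "t \<in> I"
  shows "path_dist A g (\<gamma> s) (\<gamma> t) \<le> \<bar>(t - E (\<gamma> t)) - (s - E (\<gamma> s))\<bar> / 2"
proof -
  define r where "r = t - s"
  let ?\<eta> = "\<lambda>u. \<gamma> (s + r * u)"
  have J: "s + r * u \<in> I" if "u \<in> {0..1}" for u
  proof -
    have "s + r * u \<in> closed_segment s t"
      using that unfolding r_def closed_segment_def by (auto simp: algebra_simps intro!: exI[of _ u])
    then show ?thesis
      using I closed_segment_subset[of s I t] is_interval_convex[OF I(1)] by blast
  qed
  note C1 = reparametrized_C1_curve[OF \<gamma> J unit_interval_limit_point]
  have cont: "continuous_on {0..1} (\<lambda>u. gradient_norm_sq (?\<eta> u))"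
    using C1(1) unfolding C1_curve_def by (intro continuous_on_compose2[OF continuous_gradient_norm_sq]) auto
  define X where "X = integral {0..1} (\<lambda>u. 1 + gradient_norm_sq (?\<eta> u))"
  have "path_dist A g (\<gamma> s) (\<gamma> t) \<le> curve_length A g ?\<eta>"
    unfolding path_dist_def
  proof (rule cInf_lower)
    show "curve_length A g ?\<eta> \<in>
        {curve_length A g \<eta> |\<eta>. C1_curve A {0..1} \<eta> \<and> \<eta> 0 = \<gamma> s \<and> \<eta> 1 = \<gamma> t}"
      using C1(1) unfolding r_def by (intro CollectI exI[of _ ?\<eta>]) (auto simp: r_def)
    show "bdd_below {curve_length A g \<eta> |\<eta>. C1_curve A {0..1} \<eta> \<and> \<eta> 0 = \<gamma> s \<and> \<eta> 1 = \<gamma> t}"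
      using curve_length_nonneg by (intro bdd_belowI[of _ 0]) auto
  qed
  also have "curve_length A g ?\<eta> = integral {0..1} (\<lambda>u. \<bar>r\<bar> * sqrt (gradient_norm_sq (?\<eta> u)))"
    unfolding curve_length_def
    by (rule Henstock_Kurzweil_Integration.integral_cong) (simp only: C1(2) tnorm_scaled_gradient abs_minus_cancel)
  also have "\<dots> \<le> integral {0..1} (\<lambda>u. \<bar>r\<bar> / 2 * (1 + gradient_norm_sq (?\<eta> u)))"
  proof (rule integral_le)
    show "(\<lambda>u. \<bar>r\<bar> * sqrt (gradient_norm_sq (?\<eta> u))) integrable_on {0..1}"
      "(\<lambda>u. \<bar>r\<bar> / 2 * (1 + gradient_norm_sq (?\<eta> u))) integrable_on {0..1}"
      by (intro integrable_continuous_real continuous_intros cont)+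
    fix u
    have "sqrt (gradient_norm_sq (?\<eta> u)) \<le> (1 + gradient_norm_sq (?\<eta> u)) / 2"
      using arith_geo_mean_sqrt[of 1 "gradient_norm_sq (?\<eta> u)"] gradient_norm_sq_nonneg by simp
    then show "\<bar>r\<bar> * sqrt (gradient_norm_sq (?\<eta> u)) \<le> \<bar>r\<bar> / 2 * (1 + gradient_norm_sq (?\<eta> u))"
      using mult_left_mono[of _ _ "\<bar>r\<bar>"] by fastforce
  qed
  also have "\<dots> = \<bar>r\<bar> / 2 * X"
    unfolding X_def by (rule integral_mult_right)
  also have "\<dots> = \<bar>r * X\<bar> / 2"
  proof -
    have "0 \<le> X"
      unfolding X_def using gradient_norm_sq_nonneg
      by (intro integral_nonneg integrable_continuous_real continuous_intros cont) (simp add: add_nonneg_nonneg)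
    then show ?thesis
      by (simp add: abs_mult)
  qed
  also have "r * X = (t - E (\<gamma> t)) - (s - E (\<gamma> s))"
  proof -
    have "((\<lambda>u. (s + r * u) - E (?\<eta> u)) has_vector_derivative r * (1 + gradient_norm_sq (?\<eta> u))) (at u within {0..1})"
      if u: "u \<in> {0..1}" for u
    proof -
      have "((\<lambda>u. s + r * u) has_real_derivative r) (at u within {0..1})"
        by (auto intro!: derivative_eq_intros)
      moreover have "((\<lambda>t. E (\<gamma> t)) has_real_derivative - gradient_norm_sq (?\<eta> u)) (at (s + r * u) within (\<lambda>u. s + r * u) ` {0..1})"
        using J by (intro DERIV_subset[OF energy_derivative[OF \<gamma> J[OF u]]]) auto
      ultimately have "((\<lambda>u. E (?\<eta> u)) has_real_derivative - gradient_norm_sq (?\<eta> u) * r) (at u within {0..1})"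
        using DERIV_image_chain by (fastforce simp: comp_def)
      then have "((\<lambda>u. (s + r * u) - E (?\<eta> u)) has_real_derivative r * (1 + gradient_norm_sq (?\<eta> u))) (at u within {0..1})"
        by (auto intro!: derivative_eq_intros simp: algebra_simps)
      then show ?thesis
        by (simp add: has_real_derivative_iff_has_vector_derivative)
    qed
    then have "((\<lambda>u. r * (1 + gradient_norm_sq (?\<eta> u))) has_integral
        ((s + r * 1) - E (?\<eta> 1)) - ((s + r * 0) - E (?\<eta> 0))) {0..1}"
      by (intro fundamental_theorem_of_calculus) auto
    then have "integral {0..1} (\<lambda>u. r * (1 + gradient_norm_sq (?\<eta> u))) = (t - E (\<gamma> t)) - (s - E (\<gamma> s))"
      by (simp only: integral_unique) (simp add: r_def)
    then show ?thesis
      unfolding X_def by (simp only: integral_mult_right)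
  qed
  finally show ?thesis .
qed

text \<open>
  The velocity is the negative gradient, which is continuous up to the endpoint because the curve is, so
  \<open>has_vector_derivative_at_right_endpoint\<close> applies in each chart around \<open>y\<close>.
\<close>

lemma descent_curve_extend_to_endpoint:
  assumes \<gamma>: "descent_curve {0..<T} \<gamma>" and "0 < T" and lim: "(\<gamma> \<longlongrightarrow> y) (at_left T)"
  shows "descent_curve {0..T} (\<gamma>(T := y))"
proof -
  let ?\<gamma> = "\<gamma>(T := y)"
  have at: "at t within {0..T} = at t within {0..<T}" if "t \<in> {0..<T}" for t
    by (rule at_within_nhd[of t "{..<T}"]) (use that in auto)
  have at_T: "at T within {0..T} = at_left T"
    using \<open>0 < T\<close> by (rule at_within_Icc_at_left)
  have "(?\<gamma> \<longlongrightarrow> ?\<gamma> t) (at t within {0..T})" if "t \<in> {0..T}" for t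
  proof (cases "t = T")
    case True
    have "(?\<gamma> \<longlongrightarrow> y) (at_left T)"
      using lim by (rule tendsto_cong[THEN iffD1, rotated]) (auto simp: eventually_at_filter)
    then show ?thesis
      using True at_T by simp
  next
    case False
    then have t: "t \<in> {0..<T}"
      using that by auto
    have "continuous_on {0..<T} ?\<gamma>"
      using descent_curve_continuous[OF \<gamma>] by (rule continuous_on_eq) auto
    then show ?thesis
      using t unfolding at[OF t] continuous_on_def by blast
  qed
  then have cont: "continuous_on {0..T} ?\<gamma>"
    unfolding continuous_on_def by blast
  show ?thesis
    unfolding descent_curve_def
  proof (intro conjI ballI impI cont)
    fix t c
    assume t: "t \<in> {0..T}" and c: "c \<in> A" "?\<gamma> t \<in> cdom c"
    have deriv: "((cmap c \<circ> ?\<gamma>) has_vector_derivative - gradient A g E (?\<gamma> t) c) (at t within {0..T})"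
      if t: "t \<in> {0..<T}" and c: "?\<gamma> t \<in> cdom c" for t
      unfolding at[OF t]
    proof (rule has_vector_derivative_transform[OF t])
      show "((cmap c \<circ> \<gamma>) has_vector_derivative - gradient A g E (?\<gamma> t) c) (at t within {0..<T})"
        using descent_curve_derivative[OF \<gamma> t \<open>c \<in> A\<close>] c t by auto
    qed auto
    show "((cmap c \<circ> ?\<gamma>) has_vector_derivative - gradient A g E (?\<gamma> t) c) (at t within {0..T})"
    proof (cases "t = T")
      case False
      then show ?thesis
        using deriv t c by auto
    next
      case True
      obtain \<epsilon> where \<epsilon>: "\<epsilon> > 0" "\<And>s. s \<in> {0..T} \<Longrightarrow> \<bar>s - T\<bar> < \<epsilon> \<Longrightarrow> ?\<gamma> s \<in> cdom c"
        using eventually_in_open[OF cont t open_cdom[OF c(1)] c(2)] True by metis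
      define a where "a = max 0 (T - \<epsilon> / 2)"
      have a: "0 \<le> a" "a < T" "\<And>s. s \<in> {a..T} \<Longrightarrow> s \<in> {0..T} \<and> \<bar>s - T\<bar> < \<epsilon>"
        using \<open>0 < T\<close> \<epsilon>(1) by (auto simp: a_def)
      then have a_cdom: "?\<gamma> s \<in> cdom c" if "s \<in> {a..T}" for s
        using \<epsilon>(2) that by blast
      have cont': "continuous_on {a..T} ?\<gamma>"
        using a by (intro continuous_on_subset[OF cont]) auto
      have "((cmap c \<circ> ?\<gamma>) has_vector_derivative - gradient A g E (?\<gamma> T) c) (at T within {a..T})"
      proof (rule has_vector_derivative_at_right_endpoint[OF a(2), where V = "\<lambda>s. - gradient A g E (?\<gamma> s) c"])
        show "continuous_on {a..T} (cmap c \<circ> ?\<gamma>)"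
          using a_cdom by (intro continuous_on_compose[OF cont'] continuous_on_subset[OF continuous_cmap[OF c(1)]]) blast
        have "continuous_on {a..T} (\<lambda>s. gradient A g E (?\<gamma> s) c)"
          using a_cdom by (intro continuous_on_compose2[OF continuous_gradient_component[OF c(1)] cont']) blast
        then show "continuous_on {a..T} (\<lambda>s. - gradient A g E (?\<gamma> s) c)"
          by (intro continuous_intros)
        fix s
        assume s: "a < s" "s < T"
        have "{a..T} \<subseteq> {0..T}"
          using a by auto
        then have "at s within {0..T} = at s"
          using s by (rule at_within_interval_interior)
        then show "((cmap c \<circ> ?\<gamma>) has_vector_derivative - gradient A g E (?\<gamma> s) c) (at s)"
          using deriv[of s] s a(1) a_cdom[of s] by auto
      qed
      moreover have "at T within {a..T} = at T within {0..T}"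
        by (simp add: at_within_Icc_at_left a(2) \<open>0 < T\<close>)
      ultimately show ?thesis
        using True by simp
    qed
  qed
qed

text \<open>
  The function \<open>f t = t - E(\<gamma> t)\<close> is increasing and bounded above by \<open>T - e\<close> on \<open>[0, T)\<close>, so its values
  are close to the supremum at all times close to \<open>T\<close>; by \<open>path_dist_descent_curve_le\<close> the points of the
  curve at such times are close to each other.
\<close>

lemma descent_curve_path_Cauchy:
  assumes \<gamma>: "descent_curve {0..<T} \<gamma>" and e: "\<And>x. e \<le> E x"
    and X: "\<And>k. X k \<in> {0..<T}" "X \<longlonglongrightarrow> T"
  shows "path_Cauchy A g (\<lambda>k. \<gamma> (X k))"
proof -
  define f where "f t = t - E (\<gamma> t)" for t
  have f_mono: "f s \<le> f t" if "0 \<le> s" "s \<le> t" "t < T" for s t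
  proof -
    have "{s..t} \<subseteq> {0..<T}"
      using that by auto
    then show ?thesis
      using energy_antimono[OF \<gamma> _ that(2)] that(2) unfolding f_def by fastforce
  qed
  define S where "S = (SUP t\<in>{0..<T}. f t)"
  have ne: "{0..<T} \<noteq> {}"
    using X(1) by blast
  have bdd: "bdd_above (f ` {0..<T})"
    using e unfolding f_def by (intro bdd_aboveI2[of _ _ "T - e"]) (smt (verit) atLeastLessThan_iff)
  have dist: "path_dist A g (\<gamma> s) (\<gamma> t) < \<epsilon>"
    if "0 < \<epsilon>" "s \<in> {0..<T}" "t \<in> {0..<T}" "S - \<epsilon> < f s" "S - \<epsilon> < f t" for s t \<epsilon>
  proof -
    have "f s \<le> S" "f t \<le> S"
      unfolding S_def using bdd that by (auto intro: cSUP_upper)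
    then have "\<bar>f t - f s\<bar> < \<epsilon>"
      using that by auto
    then show ?thesis
      using path_dist_descent_curve_le[OF \<gamma> _ that(2,3)] that(1) unfolding f_def
      by (auto simp: is_interval_co)
  qed
  show ?thesis
    unfolding path_Cauchy_def
  proof (intro conjI allI impI)
    have "connected (\<gamma> ` {0..<T})"
      by (intro connected_continuous_image descent_curve_continuous[OF \<gamma>]) simp
    then have "connected_component UNIV (\<gamma> (X m)) (\<gamma> (X n))" for m n
      unfolding connected_component_def using X(1) by blast
    then show "\<exists>N. \<forall>m\<ge>N. \<forall>n\<ge>N. connected_component UNIV (\<gamma> (X m)) (\<gamma> (X n))"
      by blast
    fix \<epsilon> :: real
    assume "0 < \<epsilon>"
    then have "\<exists>t\<in>{0..<T}. S - \<epsilon> < f t"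
      unfolding S_def by (intro less_cSUP_iff[THEN iffD1, OF ne bdd]) simp
    then obtain t where t: "t \<in> {0..<T}" "S - \<epsilon> < f t"
      by blast
    then obtain N where "\<And>k. k \<ge> N \<Longrightarrow> t < X k"
      using order_tendstoD(1)[OF X(2), of t] unfolding eventually_sequentially by auto
    then have N: "S - \<epsilon> < f (X k)" if "k \<ge> N" for k
      using f_mono[of t "X k"] t X(1)[of k] that by fastforce
    show "\<exists>N. \<forall>m\<ge>N. \<forall>n\<ge>N. path_dist A g (\<gamma> (X m)) (\<gamma> (X n)) < \<epsilon>"
      using dist[OF \<open>0 < \<epsilon>\<close> X(1) X(1) N N] by blast
  qed
qed

end

locale complete_energy_manifold = energy_manifold +
  fixes e
  assumes bounded_below: "\<And>x. e \<le> E x"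
    and complete_on_bounded_energy:
      "\<And>X. path_Cauchy A g X \<Longrightarrow> bounded (range (\<lambda>k. E (X k))) \<Longrightarrow> \<exists>y. X \<longlonglongrightarrow> y"
begin

text \<open>
  Along every sequence of times tending to \<open>T\<close> the curve converges.  If the limits along two sequences
  were different, the curve would diverge along the sequence that alternates between them.
\<close>

lemma descent_curve_finite_time_limit:
  assumes \<gamma>: "descent_curve {0..<T} \<gamma>" and "0 < T"
  shows "\<exists>y. (\<gamma> \<longlongrightarrow> y) (at_left T)"
proof -
  have limit: "\<exists>y. (\<lambda>k. \<gamma> (X k)) \<longlonglongrightarrow> y" if X: "\<And>k. X k \<in> {0..<T}" "X \<longlonglongrightarrow> T" for X
  proof (rule complete_on_bounded_energy)
    show "path_Cauchy A g (\<lambda>k. \<gamma> (X k))"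
      using \<gamma> bounded_below X by (rule descent_curve_path_Cauchy)
    have "E (\<gamma> (X k)) \<in> {e..E (\<gamma> 0)}" for k
    proof -
      have "{0..X k} \<subseteq> {0..<T}" "0 \<le> X k"
        using X(1)[of k] by auto
      then show ?thesis
        using energy_antimono[OF \<gamma>] bounded_below by simp
    qed
    then show "bounded (range (\<lambda>k. E (\<gamma> (X k))))"
      by (intro bounded_subset[OF bounded_closed_interval]) blast
  qed
  define X where "X k = T - T * inverse (real (Suc k))" for k
  have X: "X k \<in> {0..<T}" for k
    using \<open>0 < T\<close> unfolding X_def by (auto simp: field_simps)
  have "X \<longlonglongrightarrow> T - T * 0"
    unfolding X_def by (intro tendsto_intros LIMSEQ_inverse_real_of_nat)
  then have X_lim: "X \<longlonglongrightarrow> T"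
    by simp
  obtain y where y: "(\<lambda>k. \<gamma> (X k)) \<longlonglongrightarrow> y"
    using limit[OF X X_lim] by blast
  have "(\<gamma> \<longlongrightarrow> y) (at_left T)"
  proof (rule topological_tendstoI, rule ccontr)
    fix W
    assume W: "open W" "y \<in> W" and not: "\<not> eventually (\<lambda>t. \<gamma> t \<in> W) (at_left T)"
    have "\<exists>t. X k < t \<and> t < T \<and> \<gamma> t \<notin> W" for k
      using not X[of k] unfolding eventually_at_left_field by (metis atLeastLessThan_iff)
    then obtain Y where Y: "\<And>k. X k < Y k" "\<And>k. Y k < T" "\<And>k. \<gamma> (Y k) \<notin> W"
      by metis
    define Z where "Z k = (if even k then X k else Y k)" for k
    have "Z \<longlonglongrightarrow> T"
      by (rule tendsto_sandwich[OF _ _ X_lim tendsto_const])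
        (use Y(1,2) X in \<open>auto simp: Z_def less_imp_le intro!: always_eventually\<close>)
    moreover have "Z k \<in> {0..<T}" for k
      using X[of k] Y(1,2)[of k] unfolding Z_def by auto
    ultimately obtain z where z: "(\<lambda>k. \<gamma> (Z k)) \<longlonglongrightarrow> z"
      using limit by blast
    have mono: "strict_mono (\<lambda>k::nat. 2 * k)" "strict_mono (\<lambda>k::nat. 2 * k + 1)"
      by (auto simp: strict_mono_def)
    have "(\<lambda>k. \<gamma> (X (2 * k))) \<longlonglongrightarrow> z"
      using LIMSEQ_subseq_LIMSEQ[OF z mono(1)] unfolding Z_def by (simp add: comp_def)
    then have "z = y"
      using LIMSEQ_subseq_LIMSEQ[OF y mono(1)] LIMSEQ_unique by (auto simp: comp_def)
    moreover have "(\<lambda>k. \<gamma> (Y (2 * k + 1))) \<longlonglongrightarrow> z"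
      using LIMSEQ_subseq_LIMSEQ[OF z mono(2)] unfolding Z_def by (simp add: comp_def)
    ultimately have "eventually (\<lambda>k. \<gamma> (Y (2 * k + 1)) \<in> W) sequentially"
      using topological_tendstoD W by blast
    then show False
      using Y(3) by (simp add: eventually_sequentially)
  qed
  then show ?thesis
    by blast
qed

text \<open>
  If some time could not be reached, let \<open>M\<close> be the supremum of the reachable ones.  The curves up to times
  before \<open>M\<close> fit together to a curve on \<open>[0, M)\<close>, which extends to \<open>M\<close> by its limit there and then, by
  local existence, beyond \<open>M\<close>.
\<close>

lemma descent_curve_exists: "\<exists>\<gamma>. descent_curve {0..} \<gamma> \<and> \<gamma> 0 = x"
proof -
  define solvable where "solvable T \<longleftrightarrow> (\<exists>\<gamma>. descent_curve {0..T} \<gamma> \<and> \<gamma> 0 = x)" for T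
  have down: "solvable s" if "solvable t" "s \<le> t" for s t
    using that descent_curve_subset unfolding solvable_def by (metis atLeastatMost_subset_iff order_refl)
  have "solvable T" for T
  proof (rule ccontr)
    assume "\<not> solvable T"
    define J where "J = {t. 0 < t \<and> solvable t}"
    have "J \<noteq> {}"
      unfolding J_def solvable_def using descent_curve_exists_locally by blast
    have J_le: "t < T" if "t \<in> J" for t
      using that down \<open>\<not> solvable T\<close> unfolding J_def by (metis mem_Collect_eq not_less)
    then have bdd: "bdd_above J"
      by (meson bdd_aboveI less_imp_le)
    define M where "M = Sup J"
    have "0 < M"
    proof -
      obtain t where "t \<in> J"
        using \<open>J \<noteq> {}\<close> by blast
      then show ?thesis
        using cSup_upper[OF _ bdd, of t] unfolding M_def J_def by simp
    qed
    have "solvable t" if t: "t \<in> {0<..<M}" for t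
    proof -
      obtain s where "s \<in> J" "t < s"
        using t less_cSupE[of t J] \<open>J \<noteq> {}\<close> unfolding M_def by (metis greaterThanLessThan_iff)
      then show ?thesis
        using down[of s t] unfolding J_def by simp
    qed
    moreover have "(\<Union>t\<in>{0<..<M}. {0..<t}) = {0..<M}"
    proof
      show "{0..<M} \<subseteq> (\<Union>t\<in>{0<..<M}. {0..<t})"
      proof
        fix s
        assume "s \<in> {0..<M}"
        then show "s \<in> (\<Union>t\<in>{0<..<M}. {0..<t})"
          using dense[of s M] by force
      qed
    qed auto
    moreover have "\<exists>t\<in>{0<..<M}. 0 < t"
      using \<open>0 < M\<close> dense by auto
    ultimately obtain \<gamma> where \<gamma>: "descent_curve {0..<M} \<gamma>" "\<gamma> 0 = x"
      using descent_curve_union[of "{0<..<M}" x] unfolding solvable_def by auto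
    obtain y where y: "(\<gamma> \<longlongrightarrow> y) (at_left M)"
      using descent_curve_finite_time_limit[OF \<gamma>(1) \<open>0 < M\<close>] by blast
    have \<gamma>': "descent_curve {0..M} (\<gamma>(M := y))"
      using \<gamma>(1) \<open>0 < M\<close> y by (rule descent_curve_extend_to_endpoint)
    obtain d \<eta> where "0 < d" and \<eta>: "descent_curve {0..d} \<eta>" "\<eta> 0 = y"
      using descent_curve_exists_locally by blast
    have "solvable (M + d)"
      unfolding solvable_def
      using descent_curve_append[OF \<gamma>' \<eta>(1)] \<open>0 < M\<close> \<open>0 < d\<close> \<eta>(2) \<gamma>(2) by force
    then have "M + d \<in> J"
      unfolding J_def using \<open>0 < M\<close> \<open>0 < d\<close> by simp
    then show False
      using cSup_upper[OF _ bdd] \<open>0 < d\<close> unfolding M_def by fastforce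
  qed
  then obtain \<gamma> where "descent_curve (\<Union>T\<in>{0<..}. {0..<T}) \<gamma>" "\<gamma> 0 = x"
    using descent_curve_union[of "{0<..}" x] unfolding solvable_def by (metis greaterThan_iff zero_less_one)
  moreover have "(\<Union>T\<in>{0<..}. {0..<T}) = {0::real..}"
    using gt_ex by force
  ultimately show ?thesis
    by auto
qed

section \<open>Convergence to critical points\<close>

text \<open>
  The times \<open>T k\<close> are chosen by the mean value theorem in \<open>(k, k + 1)\<close>, such that the squared norm of the
  gradient at \<open>T k\<close> is the decrease of the energy over \<open>[k, k + 1]\<close>.
\<close>

lemma descent_curve_subconverges:
  assumes PS: "palais_smale A g E" and \<gamma>: "descent_curve {0..} \<gamma>"
  shows "\<exists>y. critical_point A E y \<and> connected_component UNIV (\<gamma> 0) y \<and>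
    (\<exists>T :: nat \<Rightarrow> real. (\<forall>k. 0 \<le> T k) \<and> filterlim T at_top sequentially \<and> (\<lambda>k. \<gamma> (T k)) \<longlonglongrightarrow> y)"
proof -
  have mono: "E (\<gamma> t) \<le> E (\<gamma> s)" if "0 \<le> s" "s \<le> t" for s t
    using that by (intro energy_antimono[OF \<gamma>]) auto
  have "\<exists>t. real k < t \<and> gradient_norm_sq (\<gamma> t) = E (\<gamma> (real k)) - E (\<gamma> (real (Suc k)))" for k
  proof -
    have I: "{real k..real (Suc k)} \<subseteq> {0..}"
      by auto
    obtain t where "real k < t"
        "E (\<gamma> (real (Suc k))) - E (\<gamma> (real k)) = (- gradient_norm_sq (\<gamma> t)) * (real (Suc k) - real k)"
    proof (rule mvt[where f = "\<lambda>t. E (\<gamma> t)" and f' = "\<lambda>t. (*) (- gradient_norm_sq (\<gamma> t))"])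
      show "real k < real (Suc k)"
        by simp
      show "continuous_on {real k..real (Suc k)} (\<lambda>t. E (\<gamma> t))"
        by (rule DERIV_continuous_on[OF energy_derivative[OF descent_curve_subset[OF \<gamma> I]]])
      fix t
      assume t: "real k < t" "t < real (Suc k)"
      have "t \<in> {0..}"
        using t by auto
      then show "((\<lambda>t. E (\<gamma> t)) has_derivative (*) (- gradient_norm_sq (\<gamma> t))) (at t)"
        using energy_derivative[OF \<gamma>, of t] at_within_interval_interior[OF I t]
        by (simp add: has_field_derivative_def)
    qed (use that in blast)
    then show ?thesis
      by (intro exI[of _ t]) simp
  qed
  then obtain T where T: "\<And>k. real k < T k" "\<And>k. gradient_norm_sq (\<gamma> (T k)) = E (\<gamma> (real k)) - E (\<gamma> (real (Suc k)))"
    by metis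
  have T_pos: "0 \<le> T k" for k
    using T(1)[of k] by linarith
  have "decseq (\<lambda>k. E (\<gamma> (real k)))"
    by (intro decseq_SucI mono) auto
  then obtain l where l: "(\<lambda>k. E (\<gamma> (real k))) \<longlonglongrightarrow> l"
    using decseq_convergent bounded_below by metis
  have slope: "(\<lambda>k. gradient_norm_sq (\<gamma> (T k))) \<longlonglongrightarrow> 0"
    using tendsto_diff[OF l LIMSEQ_Suc[OF l]] by (simp add: T(2))
  have "palais_smale_seq A g E (\<lambda>k. \<gamma> (T k))"
    unfolding palais_smale_seq_def
  proof
    show "bdd_above (range (\<lambda>k. E (\<gamma> (T k))))"
      using mono[of 0] T_pos by (intro bdd_aboveI2[of _ _ "E (\<gamma> 0)"]) auto
    have "(\<lambda>k. sqrt (gradient_norm_sq (\<gamma> (T k)))) \<longlonglongrightarrow> 0"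
      using tendsto_real_sqrt[OF slope] by simp
    from tendsto_sandwich[OF _ _ tendsto_const this]
    show "(\<lambda>k. differential_norm A g E (\<gamma> (T k))) \<longlonglongrightarrow> 0"
      by (simp add: differential_norm_le)
  qed
  then obtain r y where r: "strict_mono r" and y: "((\<lambda>k. \<gamma> (T k)) \<circ> r) \<longlonglongrightarrow> y"
    using PS unfolding palais_smale_def by blast
  have "(\<lambda>k. gradient_norm_sq (((\<lambda>k. \<gamma> (T k)) \<circ> r) k)) \<longlonglongrightarrow> gradient_norm_sq y"
    using y by (rule continuous_on_tendsto_compose[OF continuous_gradient_norm_sq]) auto
  moreover have "(\<lambda>k. gradient_norm_sq (((\<lambda>k. \<gamma> (T k)) \<circ> r) k)) \<longlonglongrightarrow> 0"
    using LIMSEQ_subseq_LIMSEQ[OF slope r] by (simp add: comp_def)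
  ultimately have "critical_point A E y"
    using LIMSEQ_unique gradient_norm_sq_eq_0_iff by blast
  moreover have "connected_component UNIV (\<gamma> 0) y"
  proof -
    let ?C = "\<gamma> ` {0..}"
    have C: "connected ?C"
      by (intro connected_continuous_image descent_curve_continuous[OF \<gamma>]) simp
    have "((\<lambda>k. \<gamma> (T k)) \<circ> r) k \<in> closure ?C" for k
      using T_pos closure_subset by fastforce
    then have "y \<in> closure ?C"
      by (intro Lim_in_closed_set[OF closed_closure _ _ y]) (auto intro!: always_eventually)
    then have "connected (insert y ?C)"
      using closure_subset[of ?C] by (intro connected_intermediate_closure[OF C]) blast+
    then show ?thesis
      unfolding connected_component_def by (intro exI[of _ "insert y ?C"]) auto
  qed
  moreover have "filterlim (T \<circ> r) at_top sequentially"
  proof -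
    have "filterlim T at_top sequentially"
      by (rule filterlim_at_top_mono[OF filterlim_real_sequentially]) (use T(1) in \<open>auto simp: less_imp_le\<close>)
    then show ?thesis
      using filterlim_compose[OF _ filterlim_subseq[OF r]] by (simp add: comp_def)
  qed
  ultimately show ?thesis
    using y T_pos by (intro exI[of _ y] conjI exI[of _ "T \<circ> r"]) (auto simp: comp_def)
qed

end

theorem theorem2p4:
  fixes A :: "('m::t2_space, 'h::{real_inner,complete_space}) chart set"
    and g :: "('m, 'h) metric_tensor"
    and E :: "'m \<Rightarrow> real"
  assumes manifold: "riemannian_manifold A g"
    and regular: "C11_loc_energy A E"
    and PS: "palais_smale A g E"
    and bounded_below: "\<exists>e. \<forall>x. E x \<ge> e"
    and complete_on_bounded_energy:
      "\<And>X. path_Cauchy A g X \<Longrightarrow> bounded (range (\<lambda>k. E (X k))) \<Longrightarrow> \<exists>y. X \<longlonglongrightarrow> y"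
  shows "(\<exists>\<phi> :: real \<Rightarrow> 'm \<Rightarrow> 'm.
      (\<forall>x. C1_curve A {0..} (\<lambda>t. \<phi> t x) \<and>
           (\<forall>t\<ge>0. velocity A {0..} (\<lambda>t. \<phi> t x) t = - gradient A g E (\<phi> t x)) \<and>
           \<phi> 0 x = x) \<and>
      (\<forall>x. \<not> critical_point A E x \<longrightarrow> strict_antimono_on {0..} (\<lambda>t. E (\<phi> t x))) \<and>
      (\<forall>x. \<exists>y. critical_point A E y \<and> connected_component UNIV x y \<and>
           (\<exists>T :: nat \<Rightarrow> real. (\<forall>k. T k \<ge> 0) \<and> filterlim T at_top sequentially \<and>
              (\<lambda>k. \<phi> (T k) x) \<longlonglongrightarrow> y))) \<and>
    (\<forall>C\<in>components (UNIV :: 'm set). \<exists>y\<in>C. critical_point A E y)"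
proof -
  obtain e where e: "\<And>x. e \<le> E x"
    using bounded_below by blast
  interpret complete_energy_manifold A g E e
    using manifold regular e complete_on_bounded_energy by unfold_locales
  obtain \<Phi> where \<Phi>: "\<And>x. descent_curve {0..} (\<Phi> x)" "\<And>x. \<Phi> x 0 = x"
    using descent_curve_exists by metis
  define \<phi> where "\<phi> t x = \<Phi> x t" for t x
  have lim: "at t within {0..} \<noteq> bot" if "t \<in> {0..}" for t :: real
  proof -
    have "at t within {t..t + 1} \<noteq> bot"
      by (simp add: trivial_limit_within islimpt_Icc)
    moreover have "{t..t + 1} \<subseteq> {0..}"
      using that by auto
    ultimately show ?thesis
      using at_le bot.extremum_uniqueI by metis
  qed
  have C1: "C1_curve A {0..} (\<lambda>t. \<phi> t x)"
    and vel: "t \<ge> 0 \<Longrightarrow> velocity A {0..} (\<lambda>t. \<phi> t x) t = - gradient A g E (\<phi> t x)" for x t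
    using reparametrized_C1_curve(1)[OF \<Phi>(1) _ lim, of 0 1 x]
      reparametrized_C1_curve(2)[OF \<Phi>(1) _ lim, of 0 1 t x]
    by (simp_all add: \<phi>_def fun_Compl_def)
  have subconverges: "\<exists>y. critical_point A E y \<and> connected_component UNIV x y \<and>
      (\<exists>T :: nat \<Rightarrow> real. (\<forall>k. T k \<ge> 0) \<and> filterlim T at_top sequentially \<and> (\<lambda>k. \<phi> (T k) x) \<longlonglongrightarrow> y)" for x
    using descent_curve_subconverges[OF PS \<Phi>(1)[of x]] unfolding \<Phi>(2) \<phi>_def .
  have "\<exists>y\<in>C. critical_point A E y" if C: "C \<in> components (UNIV :: 'm set)" for C
  proof -
    obtain x where "C = connected_component_set UNIV x"
      using C by (auto simp: components_iff)
    then show ?thesis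
      using subconverges[of x] by auto
  qed
  moreover have "strict_antimono_on {0..} (\<lambda>t. E (\<phi> t x))" if "\<not> critical_point A E x" for x
    using energy_strictly_decreasing[OF \<Phi>(1)[of x]] that unfolding \<Phi>(2) \<phi>_def .
  moreover have "\<phi> 0 x = x" for x
    unfolding \<phi>_def by (rule \<Phi>(2))
  ultimately show ?thesis
    using C1 vel subconverges by (intro conjI exI[of _ \<phi>]) blast+
qed

end
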